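(* Let $\mathbf{A}$ be an $n\times n$ Hermitian matrix, $\mathbf{b}\in\mathbb{C}^n$ a nonzero vector, and let $\mathbf{Q}_k,\mathbf{T}_k$ be the output of the Lanczos algorithm run on $(\mathbf{A},\mathbf{b})$ for $k$ steps. Let $f:\mathbb{C}\to\mathbb{C}$ be analytic in a neighborhood of the eigenvalues of $\mathbf{A}$ and $\mathbf{T}_k$, let $\Gamma$ be a simple closed curve, or a union of simple closed curves, inside this neighborhood and enclosing the eigenvalues of $\mathbf{A}$ and $\mathbf{T}_k$, and let $w\in\mathbb{C}$ with $w\notin\Lambda(\mathbf{T}_k)\cup\Lambda(\mathbf{A})$. Suppose that $S_0,S_1,\dots,S_k\subset\mathbb{R}$ satisfy $\Lambda(\mathbf{A})\subset S_0$ and $\lambda_i(\mathbf{T}_k)\in S_i$ for $i=1,\dots,k$. Then $$\| f(\mathbf{A})\mathbf{b}-\mathsf{lan}_k(f)\| \le \left(\frac{1}{2\pi}\oint_\Gamma |f(z)|\cdot\Big(\prod_{i=1}^k \|h_{w,z}\|_{S_i}\Big)\cdot\|h_{w,z}\|_{S_0}\,|\mathrm{d}z|\right)\|\mathsf{err}_k(w)\| .$$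
   Context: Lanczos algorithm (exact arithmetic): given Hermitian $\mathbf{A}$ and $\mathbf{b}\neq 0$, set $\mathbf{q}_0=0$, $\beta_0=0$, $\mathbf{q}_1=\mathbf{b}/\|\mathbf{b}\|_2$, and for $j=1,\dots,k$: $\tilde{\mathbf{q}}=\mathbf{A}\mathbf{q}_j-\beta_{j-1}\mathbf{q}_{j-1}$, $\alpha_j=\langle\tilde{\mathbf{q}},\mathbf{q}_j\rangle$, $\tilde{\mathbf{q}}_{j+1}=\tilde{\mathbf{q}}-\alpha_j\mathbf{q}_j$, $\beta_j=\|\tilde{\mathbf{q}}_{j+1}\|_2$, $\mathbf{q}_{j+1}=\tilde{\mathbf{q}}_{j+1}/\beta_j$ (it is assumed that the algorithm does not break down, i.e. the divisions needed to produce $\mathbf{q}_1,\dots,\mathbf{q}_k$ are by nonzero numbers). The output is $\mathbf{Q}_k=[\mathbf{q}_1,\dots,\mathbf{q}_k]$, which has orthonormal columns, and the real symmetric tridiagonal $k\times k$ matrix $\mathbf{T}_k$ with diagonal $\alpha_1,\dots,\alpha_k$ and off-diagonal $\beta_1,\dots,\beta_{k-1}$; they satisfy $\mathbf{A}\mathbf{Q}_k=\mathbf{Q}_k\mathbf{T}_k+\beta_k\mathbf{q}_{k+1}\mathbf{e}_k^{\mathsf T}$. $\mathsf{lan}_k(f):=\mathbf{Q}_k f(\mathbf{T}_k)\mathbf{Q}_k^{\mathsf H}\mathbf{b}$, and $\mathsf{err}_k(w):=(\mathbf{A}-w\mathbf{I})^{-1}\mathbf{b}-\mathbf{Q}_k(\mathbf{T}_k-w\mathbf{I})^{-1}\mathbf{Q}_k^{\mathsf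 H}\mathbf{b}$. For $w,z\in\mathbb{C}$, $h_{w,z}(x):=\frac{x-w}{x-z}$, and for $S\subset\mathbb{R}$, $\|h\|_S:=\sup_{x\in S}|h(x)|$ (possibly $+\infty$). $\Lambda(\mathbf{B})$ is the set of eigenvalues of $\mathbf{B}$, and $\lambda_1(\mathbf{T}_k),\dots,\lambda_k(\mathbf{T}_k)$ are the eigenvalues of $\mathbf{T}_k$. Matrix functions of Hermitian matrices are defined through the eigendecomposition. $\|\cdot\|$ is any norm $\|\mathbf{v}\|=\sqrt{\mathbf{v}^{\mathsf H}\mathbf{M}\mathbf{v}}$ induced by a positive definite matrix $\mathbf{M}$ that commutes with $\mathbf{A}$ (has the same eigenvectors as $\mathbf{A}$). "$\Gamma$ inside the neighborhood" is meant as in the Cauchy integral formula: $\Gamma$ and the regions it bounds lie in the neighborhood where $f$ is analytic, the curves are (piecewise smooth and) such that each eigenvalue is enclosed exactly once. *)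

theory Defs
  imports
    "HOL-Complex_Analysis.Complex_Analysis"
    "Jordan_Normal_Form.Matrix"
    "Jordan_Normal_Form.Schur_Decomposition"
    "Jordan_Normal_Form.Gauss_Jordan_Elimination"
    "Jordan_Normal_Form.Spectral_Radius"
begin

text \<open>Here \<open>v \<bullet>c u\<close> is the sum of the \<open>v\<^sub>i * cnj u\<^sub>i\<close>, so \<open>(M v) \<bullet>c v\<close> is
  the quadratic form of \<open>M\<close> at \<open>v\<close>.\<close>

definition hermitian_mat :: "nat \<Rightarrow> complex mat \<Rightarrow> bool" where
  "hermitian_mat n A \<longleftrightarrow> A \<in> carrier_mat n n \<and> mat_adjoint A = A"

definition pos_def_mat :: "nat \<Rightarrow> complex mat \<Rightarrow> bool" where
  "pos_def_mat n M \<longleftrightarrow> hermitian_mat n M \<and>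
     (\<forall>v \<in> carrier_vec n. v \<noteq> 0\<^sub>v n \<longrightarrow> 0 < Re ((M *\<^sub>v v) \<bullet>c v))"

definition norm2_vec :: "complex Matrix.vec \<Rightarrow> real" where
  "norm2_vec v = sqrt (Re (v \<bullet>c v))"

definition induced_norm :: "complex mat \<Rightarrow> complex Matrix.vec \<Rightarrow> real" where
  "induced_norm M v = sqrt (Re ((M *\<^sub>v v) \<bullet>c v))"


subsection \<open>Functions of Hermitian matrices\<close>

definition eigendecomposition :: "complex mat \<Rightarrow> complex mat \<Rightarrow> (nat \<Rightarrow> complex) \<Rightarrow> bool" where
  "eigendecomposition B U d \<longleftrightarrow>
     U \<in> carrier_mat (dim_row B) (dim_row B) \<and>
     mat_adjoint U * U = 1\<^sub>m (dim_row B) \<and>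
     B = U * mat_diag (dim_row B) d * mat_adjoint U"

definition matrix_fun :: "(complex \<Rightarrow> complex) \<Rightarrow> complex mat \<Rightarrow> complex mat" where
  "matrix_fun f B = (THE F. \<exists>U d. eigendecomposition B U d \<and>
     F = U * mat_diag (dim_row B) (\<lambda>i. f (d i)) * mat_adjoint U)"

lemma mat_adjoint_carrier: "U \<in> carrier_mat n m \<Longrightarrow> mat_adjoint U \<in> carrier_mat m n"
  unfolding mat_adjoint_def by auto

text \<open>The value does not depend on the chosen eigendecomposition.\<close>

lemma eigendecomposition_fun_unique:
  assumes U: "eigendecomposition B U d" and V: "eigendecomposition B V e"
  shows "U * mat_diag (dim_row B) (\<lambda>i. f (d i)) * mat_adjoint U
       = V * mat_diag (dim_row B) (\<lambda>i. f (e i)) * mat_adjoint V"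
proof -
  let ?n = "dim_row B"
  let ?U' = "mat_adjoint U" and ?V' = "mat_adjoint V"
  let ?D = "mat_diag ?n d" and ?E = "mat_diag ?n e"
  let ?Df = "mat_diag ?n (\<lambda>i. f (d i))" and ?Ef = "mat_diag ?n (\<lambda>i. f (e i))"
  let ?W = "?V' * U"
  have UC: "U \<in> carrier_mat ?n ?n" and VC: "V \<in> carrier_mat ?n ?n"
    and UU: "?U' * U = 1\<^sub>m ?n" and VV: "?V' * V = 1\<^sub>m ?n"
    and BU: "B = U * ?D * ?U'" and BV: "B = V * ?E * ?V'"
    using U V unfolding eigendecomposition_def by auto
  note UC' = mat_adjoint_carrier[OF UC] and VC' = mat_adjoint_carrier[OF VC]
  note car = UC VC UC' VC' mat_diag_dim
  have UU': "U * ?U' = 1\<^sub>m ?n" by (rule mat_mult_left_right_inverse[OF UC' UC UU])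
  have VV': "V * ?V' = 1\<^sub>m ?n" by (rule mat_mult_left_right_inverse[OF VC' VC VV])
  have WC: "?W \<in> carrier_mat ?n ?n" using car by auto
  have assoc: "X * Y * Z = X * (Y * Z)"
    if "X \<in> carrier_mat ?n ?n" "Y \<in> carrier_mat ?n ?n" "Z \<in> carrier_mat ?n ?n" for X Y Z :: "complex mat"
    using that by (rule assoc_mult_mat)
  have "?V' * (U * ?D * ?U') * U = ?W * ?D * (?U' * U)"
    using car by (simp add: assoc mult_carrier_mat[of _ ?n ?n])
  then have l: "?V' * B * U = ?W * ?D" using WC by (simp add: UU right_mult_one_mat[of _ ?n ?n] mult_carrier_mat[of _ ?n ?n] flip: BU)
  have "?V' * (V * ?E * ?V') * U = (?V' * V) * ?E * ?W"
    using car by (simp add: assoc mult_carrier_mat[of _ ?n ?n])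
  then have r: "?V' * B * U = ?E * ?W" using WC by (simp add: VV left_mult_one_mat[OF mat_diag_dim] flip: BV)
  have WD: "?W * ?D = ?E * ?W" using l r by simp
  have "?W $$ (i, j) * f (d j) = f (e i) * ?W $$ (i, j)" if "i < ?n" "j < ?n" for i j
  proof -
    have "(?W * ?D) $$ (i, j) = (?E * ?W) $$ (i, j)" using WD by simp
    then have "?W $$ (i, j) * d j = e i * ?W $$ (i, j)"
      using that by (simp only: mat_diag_mult_left[OF WC] mat_diag_mult_right[OF WC]) simp
    then show ?thesis by (cases "?W $$ (i, j) = 0") (auto simp: mult.commute)
  qed
  then have WDf: "?W * ?Df = ?Ef * ?W"
    by (simp only: mat_diag_mult_left[OF WC] mat_diag_mult_right[OF WC]) (rule eq_matI, auto)
  have "U * ?Df * ?U' = (V * ?V') * U * ?Df * ?U'" using UC by (simp add: VV')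
  also have "\<dots> = V * (?W * ?Df) * ?U'"
    using car by (simp add: assoc mult_carrier_mat[of _ ?n ?n])
  also have "\<dots> = V * (?Ef * ?W) * ?U'" by (simp only: WDf)
  also have "\<dots> = V * ?Ef * ?V' * (U * ?U')"
    using car by (simp add: assoc mult_carrier_mat[of _ ?n ?n])
  also have "\<dots> = V * ?Ef * ?V'"
    using car by (simp add: UU' right_mult_one_mat[of _ ?n ?n] mult_carrier_mat[of _ ?n ?n])
  finally show ?thesis .
qed

lemma matrix_fun_eq:
  assumes "eigendecomposition B U d"
  shows "matrix_fun f B = U * mat_diag (dim_row B) (\<lambda>i. f (d i)) * mat_adjoint U"
  unfolding matrix_fun_def using assms eigendecomposition_fun_unique by (intro the_equality) blast+

text \<open>Meaningful only for \<open>w\<close> outside the spectrum of the square matrix \<open>B\<close>.\<close>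

definition shifted_inverse :: "complex mat \<Rightarrow> complex \<Rightarrow> complex mat" where
  "shifted_inverse B w = the (mat_inverse (B - w \<cdot>\<^sub>m 1\<^sub>m (dim_row B)))"


subsection \<open>The Lanczos algorithm\<close>

text \<open>The state after \<open>j\<close> steps is the triple of \<open>q\<^sub>j\<close>, \<open>\<beta>\<^sub>j\<close> and \<open>q\<^sub>j\<^sub>+\<^sub>1\<close>.\<close>

primrec lanczos_state ::
  "complex mat \<Rightarrow> complex Matrix.vec \<Rightarrow> nat \<Rightarrow> complex Matrix.vec \<times> real \<times> complex Matrix.vec" where
  "lanczos_state A b 0 =
     (0\<^sub>v (dim_row A), 0, complex_of_real (1 / norm2_vec b) \<cdot>\<^sub>v b)"
| "lanczos_state A b (Suc j) =
     (case lanczos_state A b j of (q_prev, \<beta>_prev, q) \<Rightarrow>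
        let q' = A *\<^sub>v q - complex_of_real \<beta>_prev \<cdot>\<^sub>v q_prev;
            \<alpha> = q' \<bullet>c q;
            q'' = q' - \<alpha> \<cdot>\<^sub>v q;
            \<beta> = norm2_vec q''
        in (q, \<beta>, complex_of_real (1 / \<beta>) \<cdot>\<^sub>v q''))"

definition lanczos_q :: "complex mat \<Rightarrow> complex Matrix.vec \<Rightarrow> nat \<Rightarrow> complex Matrix.vec" where
  "lanczos_q A b j = fst (lanczos_state A b j)"

definition lanczos_beta :: "complex mat \<Rightarrow> complex Matrix.vec \<Rightarrow> nat \<Rightarrow> real" where
  "lanczos_beta A b j = fst (snd (lanczos_state A b j))"

definition lanczos_alpha :: "complex mat \<Rightarrow> complex Matrix.vec \<Rightarrow> nat \<Rightarrow> complex" where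
  "lanczos_alpha A b j =
     (A *\<^sub>v lanczos_q A b j
        - complex_of_real (lanczos_beta A b (j - 1)) \<cdot>\<^sub>v lanczos_q A b (j - 1)) \<bullet>c lanczos_q A b j"

text \<open>None of the divisors used to produce \<open>q\<^sub>1, \<dots>, q\<^sub>k\<close> vanishes.\<close>

definition lanczos_no_breakdown :: "complex mat \<Rightarrow> complex Matrix.vec \<Rightarrow> nat \<Rightarrow> bool" where
  "lanczos_no_breakdown A b k \<longleftrightarrow>
     norm2_vec b \<noteq> 0 \<and> (\<forall>j. 1 \<le> j \<and> j < k \<longrightarrow> lanczos_beta A b j \<noteq> 0)"

definition lanczos_Q :: "complex mat \<Rightarrow> complex Matrix.vec \<Rightarrow> nat \<Rightarrow> complex mat" where
  "lanczos_Q A b k = mat_of_cols (dim_row A) (map (lanczos_q A b) [1..<Suc k])"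

text \<open>Matrix indices start at \<open>0\<close>, while the coefficients are numbered from \<open>1\<close>.\<close>

definition lanczos_T :: "complex mat \<Rightarrow> complex Matrix.vec \<Rightarrow> nat \<Rightarrow> complex mat" where
  "lanczos_T A b k = Matrix.mat k k (\<lambda>(i, j).
     if i = j then lanczos_alpha A b (Suc i)
     else if j = Suc i then complex_of_real (lanczos_beta A b (Suc i))
     else if i = Suc j then complex_of_real (lanczos_beta A b (Suc j))
     else 0)"

definition lanczos_approx ::
  "complex mat \<Rightarrow> complex Matrix.vec \<Rightarrow> nat \<Rightarrow> (complex \<Rightarrow> complex) \<Rightarrow> complex Matrix.vec" where
  "lanczos_approx A b k f =
     (lanczos_Q A b k * matrix_fun f (lanczos_T A b k) * mat_adjoint (lanczos_Q A b k)) *\<^sub>v b"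

definition lanczos_err ::
  "complex mat \<Rightarrow> complex Matrix.vec \<Rightarrow> nat \<Rightarrow> complex \<Rightarrow> complex Matrix.vec" where
  "lanczos_err A b k w = shifted_inverse A w *\<^sub>v b -
     (lanczos_Q A b k * shifted_inverse (lanczos_T A b k) w * mat_adjoint (lanczos_Q A b k)) *\<^sub>v b"


subsection \<open>The contour integral bound\<close>

definition h_fun :: "complex \<Rightarrow> complex \<Rightarrow> complex \<Rightarrow> complex" where
  "h_fun w z x = (x - w) / (x - z)"

text \<open>The value at the pole \<open>x = z\<close> is infinite, instead of the \<open>0\<close> given by division by zero.\<close>

definition h_norm :: "complex \<Rightarrow> complex \<Rightarrow> real set \<Rightarrow> ennreal" where
  "h_norm w z S = (SUP x\<in>S. if complex_of_real x = z then \<infinity>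
                            else ennreal (cmod (h_fun w z (complex_of_real x))))"

text \<open>The integral of \<open>g\<close> along \<open>\<gamma>\<close> with respect to arc length.\<close>

definition arc_length_integral :: "(complex \<Rightarrow> ennreal) \<Rightarrow> (real \<Rightarrow> complex) \<Rightarrow> ennreal" where
  "arc_length_integral g \<gamma> =
     (\<integral>\<^sup>+t\<in>{0..1}. g (\<gamma> t) * ennreal (norm (vector_derivative \<gamma> (at t within {0..1}))) \<partial>lborel)"

end

theory Submission
  imports Defs
begin

text \<open>
  The residual \<open>b - (A - z I) Q (T - z I)\<^sup>-\<^sup>1 Q\<^sup>H b\<close> of the Galerkin approximation is a multiple of \<open>q\<^sub>k\<^sub>+\<^sub>1\<close>,
  and after multiplication by \<open>det (T - z I)\<close> it no longer depends on \<open>z\<close>. Hence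
  \<open>err\<^sub>k(z) = (\<Prod>i. h\<^bsub>w,z\<^esub>(\<mu>\<^sub>i)) h\<^bsub>w,z\<^esub>(A) err\<^sub>k(w)\<close>. By the Cauchy integral formula the error
  \<open>f(A) b - lan\<^sub>k(f)\<close> is, up to the sign coming from the orientation of the curves,
  \<open>1 / (2 \<pi> \<i>)\<close> times the integral of \<open>f(z) err\<^sub>k(z)\<close>, and the norm of \<open>h\<^bsub>w,z\<^esub>(A)\<close> induced by a form
  that commutes with \<open>A\<close> is at most the maximum of \<open>h\<^bsub>w,z\<^esub>\<close> in modulus over the spectrum of \<open>A\<close>.
\<close>

text \<open>No vector-valued integral is formed. For a fixed vector y the map g -> <g(A) b -
  lan_k(g), y> is a finite sum of terms \<open>c i * g (p i)\<close>, with coefficients and nodes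
  that do not depend on g. Taking g = f gives the quantity to be bounded, taking g(x) = 1/(x - z)
  gives the pairing of err_k(z) with y, and Cauchy's formula is then needed only at the finitely
  many nodes. The choice y = M v, where v is the error vector, turns the left side into the square
  of its norm; Cauchy-Schwarz for the form of M produces one factor of that norm on the right, and
  it cancels. The right-hand side can be infinite, since a set S_i may meet a curve or a curve may
  have infinite length. The final estimate is therefore carried out in \<open>ennreal\<close>, while
  the constants that are moved through integrals stay finite.\<close>

no_notation fps_nth (infixl \<open>$\<close> 75)
unbundle no vec_syntax

section \<open>Spectral theorem for Hermitian matrices\<close>

lemma mat_adjoint_dim [simp]:
  "dim_row (mat_adjoint A) = dim_col A" "dim_col (mat_adjoint A) = dim_row A"
  by (auto simp: mat_adjoint_def)

lemma mat_adjoint_index [simp]: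
  fixes A :: "complex mat"
  assumes "i < dim_col A" "j < dim_row A"
  shows "mat_adjoint A $$ (i, j) = cnj (A $$ (j, i))"
  using assms by (simp add: mat_adjoint_def mat_of_rows_index)

lemma mat_adjoint_adjoint [simp]: "mat_adjoint (mat_adjoint A) = (A :: complex mat)"
  by (rule eq_matI) auto

lemma mat_adjoint_mult:
  fixes A B :: "complex mat"
  assumes "A \<in> carrier_mat n m" "B \<in> carrier_mat m l"
  shows "mat_adjoint (A * B) = mat_adjoint B * mat_adjoint A"
  using assms by (intro eq_matI) (auto simp: scalar_prod_def mult.commute intro!: sum.cong)

lemma mult_mat_vec_index:
  fixes A :: "complex mat"
  assumes "A \<in> carrier_mat n m" "v \<in> carrier_vec m" "i < n"
  shows "(A *\<^sub>v v) $ i = (\<Sum>l<m. A $$ (i, l) * v $ l)"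
  using assms by (auto simp: scalar_prod_def lessThan_atLeast0 intro!: sum.cong)

lemma mult_mat_unit_vec:
  fixes A :: "complex mat"
  assumes "A \<in> carrier_mat n m" "j < m"
  shows "A *\<^sub>v unit_vec m j = col A j"
  using assms by (intro eq_vecI) (auto simp: scalar_prod_right_unit)

lemma smult_one_mat_mult_vec:
  "u \<in> carrier_vec n \<Longrightarrow> (c \<cdot>\<^sub>m 1\<^sub>m n) *\<^sub>v u = c \<cdot>\<^sub>v u" for u :: "complex Matrix.vec"
  by (intro eq_vecI) auto

lemma scalar_prod_zero_vec [simp]: "v \<bullet> 0\<^sub>v n = 0" for v :: "complex Matrix.vec"
  by (simp add: scalar_prod_def)

lemma cscalar_prod_sum: "v \<bullet>c u = (\<Sum>i<dim_vec u. v $ i * cnj (u $ i))" for v u :: "complex Matrix.vec"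
  by (auto simp: scalar_prod_def lessThan_atLeast0 intro!: sum.cong)

lemma cscalar_prod_adjoint:
  fixes A :: "complex mat"
  assumes A: "A \<in> carrier_mat n m" and v: "v \<in> carrier_vec m" and u: "u \<in> carrier_vec n"
  shows "(A *\<^sub>v v) \<bullet>c u = v \<bullet>c (mat_adjoint A *\<^sub>v u)"
proof -
  have "(A *\<^sub>v v) \<bullet>c u = (\<Sum>i<n. \<Sum>j<m. A $$ (i, j) * v $ j * cnj (u $ i))"
    unfolding cscalar_prod_sum using assms
    by (simp add: scalar_prod_def sum_distrib_right lessThan_atLeast0)
  also have "\<dots> = (\<Sum>j<m. \<Sum>i<n. A $$ (i, j) * v $ j * cnj (u $ i))"
    by (rule sum.swap)
  also have "\<dots> = v \<bullet>c (mat_adjoint A *\<^sub>v u)"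
    unfolding cscalar_prod_sum using assms
    by (simp add: scalar_prod_def sum_distrib_left lessThan_atLeast0 mult_ac)
  finally show ?thesis .
qed

lemma cscalar_prod_cnj: "dim_vec v = dim_vec u \<Longrightarrow> cnj (v \<bullet>c u) = u \<bullet>c v" for v u :: "complex Matrix.vec"
  by (simp add: cscalar_prod_sum mult.commute)

lemma cscalar_prod_diff_left: "\<lbrakk>dim_vec x = dim_vec u; dim_vec y = dim_vec u\<rbrakk> \<Longrightarrow> (x - y) \<bullet>c u = x \<bullet>c u - y \<bullet>c u"
  for x y u :: "complex Matrix.vec"
  by (simp add: cscalar_prod_sum sum_subtractf algebra_simps)

lemma cscalar_prod_diff_right: "dim_vec x = dim_vec y \<Longrightarrow> u \<bullet>c (x - y) = u \<bullet>c x - u \<bullet>c y"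
  for x y u :: "complex Matrix.vec"
  by (simp add: cscalar_prod_sum sum_subtractf algebra_simps)

lemma cscalar_prod_add_right: "dim_vec x = dim_vec y \<Longrightarrow> u \<bullet>c (x + y) = u \<bullet>c x + u \<bullet>c y"
  for x y u :: "complex Matrix.vec"
  by (simp add: cscalar_prod_sum sum.distrib algebra_simps)

lemma cscalar_prod_smult_left: "dim_vec x = dim_vec u \<Longrightarrow> (c \<cdot>\<^sub>v x) \<bullet>c u = c * (x \<bullet>c u)"
  for x u :: "complex Matrix.vec"
  by (simp add: cscalar_prod_sum sum_distrib_left mult_ac)

lemma cscalar_prod_smult_right: "u \<bullet>c (c \<cdot>\<^sub>v x) = cnj c * (u \<bullet>c x)"
  for x u :: "complex Matrix.vec"
  by (simp add: cscalar_prod_sum sum_distrib_left mult_ac)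

lemma cscalar_prod_self: "v \<bullet>c v = complex_of_real ((norm2_vec v)\<^sup>2)"
proof -
  have "v \<bullet>c v = complex_of_real (\<Sum>i<dim_vec v. (cmod (v $ i))\<^sup>2)"
    by (simp add: cscalar_prod_sum flip: complex_norm_square)
  moreover have "(\<Sum>i<dim_vec v. (cmod (v $ i))\<^sup>2) \<ge> 0"
    by (intro sum_nonneg) auto
  ultimately show ?thesis by (simp add: norm2_vec_def)
qed

lemma norm2_vec_eq_0: "v \<in> carrier_vec n \<Longrightarrow> norm2_vec v = 0 \<longleftrightarrow> v = 0\<^sub>v n"
  using cscalar_prod_self[of v] conjugate_square_eq_0_vec[of v n] by auto

section \<open>Unitary completion and diagonalisation by deflation\<close>

lemma unitary_columns:
  fixes W :: "complex mat"
  assumes W: "W \<in> carrier_mat n n"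
    and orth: "\<And>i j. i < n \<Longrightarrow> j < n \<Longrightarrow> col W i \<bullet>c col W j = (if i = j then 1 else 0)"
  shows "mat_adjoint W * W = 1\<^sub>m n"
proof (rule eq_matI)
  fix i j assume ij: "i < dim_row (1\<^sub>m n)" "j < dim_col (1\<^sub>m n)"
  then have "(mat_adjoint W * W) $$ (i, j) = col W j \<bullet>c col W i"
    using W by (auto simp: scalar_prod_def mult.commute intro!: sum.cong)
  then show "(mat_adjoint W * W) $$ (i, j) = 1\<^sub>m n $$ (i, j)"
    using orth[of j i] ij by auto
qed (use W in auto)

text \<open>Gram-Schmidt applied to a basis that starts with \<open>v\<close> keeps \<open>v\<close>
  as its first vector. Its output is orthogonal but not normalised, so the columns are scaled
  afterwards, and \<open>c\<close> is the scaling factor of \<open>v\<close>.\<close>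

lemma unitary_completion:
  fixes v :: "complex Matrix.vec"
  assumes v: "v \<in> carrier_vec n" and v0: "v \<noteq> 0\<^sub>v n"
  obtains W c where "W \<in> carrier_mat n n" "mat_adjoint W * W = 1\<^sub>m n" "col W 0 = c \<cdot>\<^sub>v v"
proof -
  have n: "n > 0" using v v0 by (intro gr0I) auto
  interpret cof_vec_space n "TYPE(complex)" .
  define b where "b = basis_completion v"
  define ws where "ws = gram_schmidt n b"
  from basis_completion[OF v v0, folded b_def]
  have dist_b: "distinct b" and indep: "\<not> lin_dep (set b)" and b: "set b \<subseteq> carrier_vec n"
    and hdb: "hd b = v" and len_b: "length b = n" by auto
  from hdb len_b n obtain vs where bv: "b = v # vs" by (cases b, auto)
  from gram_schmidt_result[OF b dist_b indep refl, folded ws_def]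
  have ws: "set ws \<subseteq> carrier_vec n" "corthogonal ws" "length ws = n" by (auto simp: len_b)
  have "hd ws = v" unfolding ws_def bv by (rule gram_schmidt_hd[OF v])
  then have ws0: "ws ! 0 = v" using ws n by (cases ws) auto
  define W where "W = mat_of_cols n (map (\<lambda>u. complex_of_real (1 / norm2_vec u) \<cdot>\<^sub>v u) ws)"
  have W: "W \<in> carrier_mat n n" using ws by (auto simp: W_def)
  have wsc: "ws ! i \<in> carrier_vec n" if "i < n" for i using ws that by auto
  have col: "col W i = complex_of_real (1 / norm2_vec (ws ! i)) \<cdot>\<^sub>v (ws ! i)" if "i < n" for i
    unfolding W_def using that ws wsc[OF that] by (subst col_mat_of_cols) auto
  have "mat_adjoint W * W = 1\<^sub>m n"
  proof (rule unitary_columns[OF W])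
    fix i j assume ij: "i < n" "j < n"
    have o: "(ws ! i \<bullet>c ws ! j = 0) = (i \<noteq> j)"
      using corthogonalD[OF ws(2), of i j] ij ws by auto
    have d: "dim_vec (ws ! i) = n" "dim_vec (ws ! j) = n" using wsc ij by auto
    show "col W i \<bullet>c col W j = (if i = j then 1 else 0)"
    proof (cases "i = j")
      case True
      then have "norm2_vec (ws ! j) \<noteq> 0" using o cscalar_prod_self[of "ws ! j"] by auto
      then show ?thesis using True ij d
        by (simp add: col cscalar_prod_smult_left cscalar_prod_smult_right)
          (simp add: cscalar_prod_self power2_eq_square)
    next
      case False
      then show ?thesis using o ij d
        by (simp add: col cscalar_prod_smult_left cscalar_prod_smult_right)
    qed
  qed
  moreover have "col W 0 = complex_of_real (1 / norm2_vec v) \<cdot>\<^sub>v v" using col[OF n] ws0 by simp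
  ultimately show ?thesis using W that by blast
qed

lemma mat_adjoint_four_block_zero:
  fixes U :: "complex mat"
  assumes "U \<in> carrier_mat n n"
  shows "mat_adjoint (four_block_mat (1\<^sub>m 1) (0\<^sub>m 1 n) (0\<^sub>m n 1) U)
    = four_block_mat (1\<^sub>m 1) (0\<^sub>m 1 n) (0\<^sub>m n 1) (mat_adjoint U)"
  using assms by (intro eq_matI) auto

lemma mult_four_block_diag:
  fixes X Y B C :: "'a :: comm_ring_1 mat"
  assumes "X \<in> carrier_mat m m" "Y \<in> carrier_mat m m" "B \<in> carrier_mat n n" "C \<in> carrier_mat n n"
  shows "four_block_mat X (0\<^sub>m m n) (0\<^sub>m n m) B * four_block_mat Y (0\<^sub>m m n) (0\<^sub>m n m) C
    = four_block_mat (X * Y) (0\<^sub>m m n) (0\<^sub>m n m) (B * C)"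
  using assms by (subst mult_four_block_mat[of _ m m _ n _ n _ _ m _ n]) auto

text \<open>Deflation: an eigenvector is completed to a unitary \<open>W\<close>. Then
  \<open>H\<close>, the conjugate of \<open>A\<close> by \<open>W\<close>, is again Hermitian, and
  its first column is a multiple of the first unit vector, so by symmetry its first row is too. The
  remaining block is Hermitian of size one less, and its diagonalisation is extended by a 1 in the
  corner.\<close>

theorem hermitian_eigendecomposition:
  assumes "hermitian_mat n A"
  shows "\<exists>U d. eigendecomposition A U d"
  using assms
proof (induction n arbitrary: A)
  case 0
  then have A: "A \<in> carrier_mat 0 0" by (auto simp: hermitian_mat_def)
  show ?case
    by (intro exI[of _ "1\<^sub>m 0"] exI) (use A in \<open>auto simp: eigendecomposition_def\<close>)
next
  case (Suc n)
  let ?n = "Suc n"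
  have A: "A \<in> carrier_mat ?n ?n" and adj: "mat_adjoint A = A"
    using Suc.prems by (auto simp: hermitian_mat_def)
  from spectrum_non_empty[OF A] obtain e where "eigenvalue A e" by (auto simp: spectrum_def)
  then obtain v where v: "v \<in> carrier_vec ?n" "v \<noteq> 0\<^sub>v ?n" "A *\<^sub>v v = e \<cdot>\<^sub>v v"
    using A by (auto simp: eigenvalue_def eigenvector_def)
  obtain W c where W: "W \<in> carrier_mat ?n ?n" "mat_adjoint W * W = 1\<^sub>m ?n" "col W 0 = c \<cdot>\<^sub>v v"
    using unitary_completion[OF v(1,2)] .
  let ?W' = "mat_adjoint W"
  have W': "?W' \<in> carrier_mat ?n ?n" using W by (auto intro: mat_adjoint_carrier)
  have WW': "W * ?W' = 1\<^sub>m ?n" by (rule mat_mult_left_right_inverse[OF W' W(1,2)])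
  define H where "H = ?W' * A * W"
  have H: "H \<in> carrier_mat ?n ?n" using A W W' by (auto simp: H_def)
  have Hadj: "mat_adjoint H = H"
  proof -
    have "mat_adjoint (?W' * A * W) = ?W' * (mat_adjoint A * W)"
      using A W W' mat_adjoint_carrier[OF A] by (simp add: mat_adjoint_mult[of _ ?n ?n _ ?n] mult_carrier_mat[of _ ?n ?n]
          assoc_mult_mat[of _ ?n ?n _ ?n _ ?n])
    then show ?thesis using A W W' by (simp add: H_def adj assoc_mult_mat[of _ ?n ?n _ ?n _ ?n])
  qed
  have "A * W = W * H"
  proof -
    have "W * H = (W * ?W') * (A * W)"
      unfolding H_def using A W W'
      by (simp add: assoc_mult_mat[of _ ?n ?n _ ?n _ ?n] mult_carrier_mat[of _ ?n ?n])
    then show ?thesis using WW' A W by (simp add: left_mult_one_mat[of _ ?n ?n])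
  qed
  have col0: "col H 0 = e \<cdot>\<^sub>v unit_vec ?n 0"
  proof -
    have "col H 0 = ?W' *\<^sub>v (A *\<^sub>v col W 0)"
      using A W W' col_mult2[of ?W' ?n ?n "A * W" ?n 0] col_mult2[of A ?n ?n W ?n 0] unfolding H_def
      by (simp only: assoc_mult_mat[of _ ?n ?n _ ?n _ ?n] mult_carrier_mat[of _ ?n ?n])
    also have "A *\<^sub>v col W 0 = e \<cdot>\<^sub>v col W 0"
      using A v by (simp add: W(3) mult_mat_vec[of _ ?n ?n] smult_smult_assoc mult.commute)
    also have "?W' *\<^sub>v (e \<cdot>\<^sub>v col W 0) = e \<cdot>\<^sub>v (?W' *\<^sub>v col W 0)"
      by (rule mult_mat_vec[OF W']) (simp add: W(3) v(1))
    also have "?W' *\<^sub>v col W 0 = col (?W' * W) 0"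
      by (rule col_mult2[OF W' W(1), symmetric]) simp
    finally show ?thesis using W by simp
  qed
  have H0: "H $$ (i, 0) = (if i = 0 then e else 0)" if "i < ?n" for i
    using arg_cong[OF col0, of "\<lambda>x. x $ i"] that H by auto
  \<comment> \<open>The symmetry of \<open>H\<close> transfers the zeros; the corner entry is
    already known from the first column.\<close>
  have H0': "H $$ (0, i) = (if i = 0 then e else 0)" if "i < ?n" for i
  proof -
    have "H $$ (0, i) = cnj (H $$ (i, 0))"
      using arg_cong[OF Hadj, of "\<lambda>X. X $$ (0, i)"] that H by auto
    then show ?thesis using H0[OF that] H0[of 0]
      by (metis (no_types, lifting) complex_cnj_zero zero_less_Suc)
  qed
  define B where "B = Matrix.mat n n (\<lambda>(i, j). H $$ (Suc i, Suc j))"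
  have B: "B \<in> carrier_mat n n" by (auto simp: B_def)
  have "hermitian_mat n B"
    unfolding hermitian_mat_def
  proof (intro conjI B eq_matI)
    fix i j assume "i < dim_row B" "j < dim_col B"
    then show "mat_adjoint B $$ (i, j) = B $$ (i, j)"
      using arg_cong[OF Hadj, of "\<lambda>X. X $$ (Suc i, Suc j)"] H by (auto simp: B_def)
  qed (auto simp: B_def)
  from Suc.IH[OF this] obtain U d where "eigendecomposition B U d" by blast
  then have U: "U \<in> carrier_mat n n" "mat_adjoint U * U = 1\<^sub>m n"
    and BU: "B = U * mat_diag n d * mat_adjoint U"
    using B by (auto simp: eigendecomposition_def)
  have U': "mat_adjoint U \<in> carrier_mat n n" using U by (auto intro: mat_adjoint_carrier)
  define V where "V = four_block_mat (1\<^sub>m 1) (0\<^sub>m 1 n) (0\<^sub>m n 1) U"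
  define d' where "d' = (\<lambda>i. if i = 0 then e else d (i - 1))"
  have V: "V \<in> carrier_mat ?n ?n" unfolding V_def using U by auto
  have V': "mat_adjoint V = four_block_mat (1\<^sub>m 1) (0\<^sub>m 1 n) (0\<^sub>m n 1) (mat_adjoint U)"
    unfolding V_def by (rule mat_adjoint_four_block_zero[OF U(1)])
  have V'c: "mat_adjoint V \<in> carrier_mat ?n ?n" using V by (rule mat_adjoint_carrier)
  have D: "mat_diag ?n d' = four_block_mat (e \<cdot>\<^sub>m 1\<^sub>m 1) (0\<^sub>m 1 n) (0\<^sub>m n 1) (mat_diag n d)"
    by (intro eq_matI) (auto simp: mat_diag_def d'_def)
  have HB: "H = four_block_mat (e \<cdot>\<^sub>m 1\<^sub>m 1) (0\<^sub>m 1 n) (0\<^sub>m n 1) B"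
    using H H0 H0' by (intro eq_matI) (auto simp: B_def)
  have VV: "mat_adjoint V * V = 1\<^sub>m ?n"
    unfolding V' unfolding V_def using U U'
    by (subst mult_four_block_diag) (auto simp: four_block_one_mat[of 1 n, simplified])
  have HV: "H = V * mat_diag ?n d' * mat_adjoint V"
    unfolding HB D V' unfolding V_def BU using U U'
    by (simp add: mult_four_block_diag[of _ "Suc 0" _ _ n] mult_carrier_mat[of _ n n])
  have "A = W * H * ?W'"
  proof -
    have "W * H * ?W' = A * (W * ?W')" 
      using A W W' by (simp add: assoc_mult_mat[of _ ?n ?n _ ?n _ ?n] flip: \<open>A * W = W * H\<close>)
    then show ?thesis using WW' A by (simp add: right_mult_one_mat[of _ ?n ?n])
  qed
  also have "\<dots> = (W * V) * mat_diag ?n d' * mat_adjoint (W * V)"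
    unfolding HV using W W' V V'c
    by (simp add: mat_adjoint_mult[of _ ?n ?n _ ?n] assoc_mult_mat[of _ ?n ?n _ ?n _ ?n]
        mult_carrier_mat[of _ ?n ?n] mat_diag_dim)
  finally have 1: "A = (W * V) * mat_diag ?n d' * mat_adjoint (W * V)" .
  have "mat_adjoint (W * V) * (W * V) = mat_adjoint V * (?W' * W) * V"
    using W(1) W' V V'c
    by (simp add: mat_adjoint_mult[of _ ?n ?n _ ?n] assoc_mult_mat[of _ ?n ?n _ ?n _ ?n]
        mult_carrier_mat[of _ ?n ?n])
  then have 2: "mat_adjoint (W * V) * (W * V) = 1\<^sub>m ?n"
    using W V'c VV by (simp add: right_mult_one_mat[of _ ?n ?n])
  show ?case
    by (intro exI[of _ "W * V"] exI[of _ d']) (use A W V 1 2 in \<open>auto simp: eigendecomposition_def\<close>)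
qed

section \<open>Functional calculus\<close>

text \<open>A single pair of \<open>U\<close> and \<open>d\<close> serves every \<open>g\<close> at
  once, so identities between functions of \<open>A\<close> reduce to identities between diagonal
  matrices. The entries of \<open>d\<close> are eigenvalues because similar matrices share their
  characteristic polynomial.\<close>

lemma hermitian_diagonalisation:
  assumes "hermitian_mat n A"
  shows "\<exists>U d. U \<in> carrier_mat n n \<and> mat_adjoint U * U = 1\<^sub>m n \<and> U * mat_adjoint U = 1\<^sub>m n
    \<and> A = U * mat_diag n d * mat_adjoint U
    \<and> (\<forall>g. matrix_fun g A = U * mat_diag n (\<lambda>i. g (d i)) * mat_adjoint U)
    \<and> (\<forall>i<n. d i \<in> spectrum A)"
proof -
  from hermitian_eigendecomposition[OF assms] obtain U d where ed: "eigendecomposition A U d" by blast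
  have A: "A \<in> carrier_mat n n" using assms by (simp add: hermitian_mat_def)
  then have U: "U \<in> carrier_mat n n" "mat_adjoint U * U = 1\<^sub>m n"
    and AU: "A = U * mat_diag n d * mat_adjoint U"
    using ed by (auto simp: eigendecomposition_def)
  note U' = mat_adjoint_carrier[OF U(1)]
  have UU': "U * mat_adjoint U = 1\<^sub>m n" by (rule mat_mult_left_right_inverse[OF U' U])
  have "similar_mat_wit A (mat_diag n d) U (mat_adjoint U)"
    by (rule similar_mat_witI[of _ _ n]) (use U U' UU' AU A in auto)
  then have "char_poly A = char_poly (mat_diag n d)"
    by (intro char_poly_similar) (auto simp: similar_mat_def)
  also have "\<dots> = (\<Prod>a\<leftarrow>diag_mat (mat_diag n d). [:- a, 1:])"
    by (rule char_poly_upper_triangular[of _ n]) (auto simp: mat_diag_def)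
  also have "diag_mat (mat_diag n d) = map d [0..<n]"
    by (auto simp: diag_mat_def mat_diag_def)
  finally have "d i \<in> spectrum A" if "i < n" for i
    using that by (auto simp: spectrum_root_char_poly[OF A] poly_prod_list prod_list_zero_iff)
  then show ?thesis using U UU' AU matrix_fun_eq[OF ed] A
    by (intro exI[of _ U] exI[of _ d]) auto
qed

lemma matrix_fun_carrier:
  assumes "hermitian_mat n A"
  shows "matrix_fun g A \<in> carrier_mat n n"
proof -
  obtain U d where U: "U \<in> carrier_mat n n"
    and g: "\<And>g. matrix_fun g A = U * mat_diag n (\<lambda>i. g (d i)) * mat_adjoint U"
    using hermitian_diagonalisation[OF assms] by blast
  show ?thesis unfolding g using U by (auto intro!: mult_carrier_mat[of _ n n] mat_adjoint_carrier)
qed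

lemma matrix_fun_cong:
  assumes "hermitian_mat n A" "\<And>x. x \<in> spectrum A \<Longrightarrow> g x = h x"
  shows "matrix_fun g A = matrix_fun h A"
proof -
  obtain U d where d: "\<And>i. i < n \<Longrightarrow> d i \<in> spectrum A"
    and g: "\<And>g. matrix_fun g A = U * mat_diag n (\<lambda>i. g (d i)) * mat_adjoint U"
    using hermitian_diagonalisation[OF assms(1)] by blast
  have "mat_diag n (\<lambda>i. g (d i)) = mat_diag n (\<lambda>i. h (d i))"
    using assms(2) d by (intro eq_matI) (auto simp: mat_diag_def)
  then show ?thesis by (simp add: g)
qed

lemma matrix_fun_mult:
  assumes "hermitian_mat n A"
  shows "matrix_fun g A * matrix_fun h A = matrix_fun (\<lambda>x. g x * h x) A"
proof -
  obtain U d where U: "U \<in> carrier_mat n n" "mat_adjoint U * U = 1\<^sub>m n"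
    and g: "\<And>g. matrix_fun g A = U * mat_diag n (\<lambda>i. g (d i)) * mat_adjoint U"
    using hermitian_diagonalisation[OF assms(1)] by blast
  note U' = mat_adjoint_carrier[OF U(1)]
  let ?G = "mat_diag n (\<lambda>i. g (d i))" and ?H = "mat_diag n (\<lambda>i. h (d i))"
  have "matrix_fun g A * matrix_fun h A = U * ?G * (mat_adjoint U * U) * ?H * mat_adjoint U"
    unfolding g using U(1) U'
    by (simp add: assoc_mult_mat[of _ n n _ n _ n] mult_carrier_mat[of _ n n] mat_diag_dim del: mat_diag_diag)
  also have "\<dots> = U * (?G * ?H) * mat_adjoint U"
    using U U' by (simp add: right_mult_one_mat[of _ n n] assoc_mult_mat[of _ n n _ n _ n]
        mult_carrier_mat[of _ n n] mat_diag_dim del: mat_diag_diag)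
  finally show ?thesis by (simp add: g)
qed

lemma matrix_fun_diff:
  assumes "hermitian_mat n A"
  shows "matrix_fun (\<lambda>x. g x - h x) A = matrix_fun g A - matrix_fun h A"
proof -
  obtain U d where U: "U \<in> carrier_mat n n"
    and g: "\<And>g. matrix_fun g A = U * mat_diag n (\<lambda>i. g (d i)) * mat_adjoint U"
    using hermitian_diagonalisation[OF assms(1)] by blast
  note U' = mat_adjoint_carrier[OF U(1)]
  let ?G = "mat_diag n (\<lambda>i. g (d i))" and ?H = "mat_diag n (\<lambda>i. h (d i))"
  have "mat_diag n (\<lambda>i. g (d i) - h (d i)) = ?G - ?H"
    by (intro eq_matI) (auto simp: mat_diag_def)
  moreover have "U * (?G - ?H) * mat_adjoint U = U * ?G * mat_adjoint U - U * ?H * mat_adjoint U"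
    using U U' by (simp add: mult_minus_distrib_mat[of _ n n _ n] minus_mult_distrib_mat[of _ n n _ _ n]
        mult_carrier_mat[of _ n n] mat_diag_dim)
  ultimately show ?thesis by (simp add: g)
qed

lemma matrix_fun_const:
  assumes "hermitian_mat n A"
  shows "matrix_fun (\<lambda>x. c) A = c \<cdot>\<^sub>m 1\<^sub>m n"
proof -
  obtain U d where U: "U \<in> carrier_mat n n" "U * mat_adjoint U = 1\<^sub>m n"
    and g: "\<And>g. matrix_fun g A = U * mat_diag n (\<lambda>i. g (d i)) * mat_adjoint U"
    using hermitian_diagonalisation[OF assms(1)] by blast
  have "mat_diag n (\<lambda>i. c) = c \<cdot>\<^sub>m 1\<^sub>m n" by (intro eq_matI) (auto simp: mat_diag_def)
  then show ?thesis unfolding g using U mat_adjoint_carrier[OF U(1)]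
    by (simp add: mult_smult_distrib[of _ n n _ n] mult_smult_assoc_mat[of _ n n _ n] right_mult_one_mat[of _ n n])
qed

lemma matrix_fun_ident:
  assumes "hermitian_mat n A"
  shows "matrix_fun (\<lambda>x. x) A = A"
proof -
  obtain U d where AU: "A = U * mat_diag n d * mat_adjoint U"
    and g: "\<And>g. matrix_fun g A = U * mat_diag n (\<lambda>i. g (d i)) * mat_adjoint U"
    using hermitian_diagonalisation[OF assms(1)] by blast
  show ?thesis unfolding g by (rule AU[symmetric])
qed

lemma matrix_fun_adjoint:
  assumes "hermitian_mat n A"
  shows "mat_adjoint (matrix_fun g A) = matrix_fun (\<lambda>x. cnj (g x)) A"
proof -
  obtain U d where U: "U \<in> carrier_mat n n"
    and g: "\<And>g. matrix_fun g A = U * mat_diag n (\<lambda>i. g (d i)) * mat_adjoint U"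
    using hermitian_diagonalisation[OF assms(1)] by blast
  note U' = mat_adjoint_carrier[OF U(1)]
  let ?G = "mat_diag n (\<lambda>i. g (d i))"
  have a: "mat_adjoint ?G = mat_diag n (\<lambda>i. cnj (g (d i)))"
    by (intro eq_matI) (auto simp: mat_diag_def)
  have "mat_adjoint (U * ?G * mat_adjoint U) = mat_adjoint (mat_adjoint U) * mat_adjoint (U * ?G)"
    by (rule mat_adjoint_mult[OF mult_carrier_mat[OF U mat_diag_dim] U'])
  also have "mat_adjoint (U * ?G) = mat_adjoint ?G * mat_adjoint U"
    by (rule mat_adjoint_mult[OF U mat_diag_dim])
  finally show ?thesis
    using U U' by (simp add: g a assoc_mult_mat[of _ n n _ n _ n] mat_diag_dim)
qed

text \<open>In an eigenbasis of \<open>A\<close>, commuting with \<open>A\<close> says that the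
  entry \<open>(i, j)\<close> of the transformed matrix \<open>W\<close> vanishes unless
  \<open>d i = d j\<close>. This condition persists when \<open>d\<close> is replaced by its image
  under \<open>g\<close>.\<close>

lemma matrix_fun_commute:
  assumes A: "hermitian_mat n A" and M: "M \<in> carrier_mat n n" and MA: "M * A = A * M"
  shows "M * matrix_fun g A = matrix_fun g A * M"
proof -
  obtain U d where U: "U \<in> carrier_mat n n" "mat_adjoint U * U = 1\<^sub>m n" "U * mat_adjoint U = 1\<^sub>m n"
    and AU: "A = U * mat_diag n d * mat_adjoint U"
    and g: "\<And>g. matrix_fun g A = U * mat_diag n (\<lambda>i. g (d i)) * mat_adjoint U"
    using hermitian_diagonalisation[OF A] by blast
  let ?U = "mat_adjoint U"
  note U' = mat_adjoint_carrier[OF U(1)]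
  let ?D = "mat_diag n d" and ?G = "mat_diag n (\<lambda>i. g (d i))"
  define W where "W = ?U * M * U"
  have W: "W \<in> carrier_mat n n" using U U' M by (auto simp: W_def)
  note ac = assoc_mult_mat[of _ n n _ n _ n] mult_carrier_mat[of _ n n] mat_diag_dim
  have conj: "M * (U * X * ?U) = U * (W * X) * ?U" "U * X * ?U * M = U * (X * W) * ?U"
    if X: "X \<in> carrier_mat n n" for X
  proof -
    have "U * (W * X) * ?U = (U * ?U) * M * (U * X * ?U)"
      unfolding W_def using U(1) U' M X by (simp add: ac)
    then show "M * (U * X * ?U) = U * (W * X) * ?U"
      using U(1,3) U' M X by (simp add: left_mult_one_mat[of _ n n])
    have "U * (X * W) * ?U = U * X * ?U * M * (U * ?U)"
      unfolding W_def using U(1) U' M X by (simp add: ac)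
    then show "U * X * ?U * M = U * (X * W) * ?U"
      using U(1,3) U' M X by (simp add: right_mult_one_mat[of _ n n] ac)
  qed
  have "U * (W * ?D) * ?U = U * (?D * W) * ?U"
    using MA conj[of ?D] unfolding AU by simp
  then have "?U * (U * (W * ?D) * ?U) * U = ?U * (U * (?D * W) * ?U) * U" by simp
  moreover have "?U * (U * X * ?U) * U = X" if X: "X \<in> carrier_mat n n" for X
  proof -
    have "?U * (U * X * ?U) * U = (?U * U) * X * (?U * U)" using U(1) U' X by (simp add: ac)
    then show ?thesis using U(2) X by (simp add: left_mult_one_mat[of _ n n] right_mult_one_mat[of _ n n])
  qed
  ultimately have WD: "W * ?D = ?D * W" using W by (simp add: mult_carrier_mat[of _ n n])
  have "W $$ (i, j) * g (d j) = g (d i) * W $$ (i, j)" if "i < n" "j < n" for i j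
  proof -
    have "(W * ?D) $$ (i, j) = (?D * W) $$ (i, j)" using WD by simp
    then have "W $$ (i, j) * d j = d i * W $$ (i, j)"
      using that by (simp only: mat_diag_mult_left[OF W] mat_diag_mult_right[OF W]) simp
    then show ?thesis by (cases "W $$ (i, j) = 0") (auto simp: mult.commute)
  qed
  then have "W * ?G = ?G * W"
    by (simp only: mat_diag_mult_left[OF W] mat_diag_mult_right[OF W]) (rule eq_matI, auto)
  then show ?thesis unfolding g using conj[of ?G] by simp
qed

text \<open>The order of the quantifiers is the point: \<open>c\<close> and \<open>d\<close> are
  fixed before \<open>g\<close>, so that the same weights and nodes describe both f and the
  resolvent functions. The weight \<open>c i\<close> is the product of the i-th coordinate of
  \<open>b\<close> in the eigenbasis with the conjugate of that of \<open>y\<close>.\<close>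

lemma matrix_fun_cscalar_prod:
  assumes A: "hermitian_mat n A" and b: "b \<in> carrier_vec n" and y: "y \<in> carrier_vec n"
  shows "\<exists>c d. (\<forall>i<n. d i \<in> spectrum A) \<and> (\<forall>g. (matrix_fun g A *\<^sub>v b) \<bullet>c y = (\<Sum>i<n. c i * g (d i)))"
proof -
  obtain U d where U: "U \<in> carrier_mat n n" and d: "\<And>i. i < n \<Longrightarrow> d i \<in> spectrum A"
    and g: "\<And>g. matrix_fun g A = U * mat_diag n (\<lambda>i. g (d i)) * mat_adjoint U"
    using hermitian_diagonalisation[OF A] by blast
  let ?U = "mat_adjoint U"
  note U' = mat_adjoint_carrier[OF U(1)]
  have "(matrix_fun g A *\<^sub>v b) \<bullet>c y = (\<Sum>i<n. ((?U *\<^sub>v b) $ i * cnj ((?U *\<^sub>v y) $ i)) * g (d i))" for g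
  proof -
    let ?G = "mat_diag n (\<lambda>i. g (d i))"
    have "matrix_fun g A *\<^sub>v b = U *\<^sub>v (?G *\<^sub>v (?U *\<^sub>v b))"
      unfolding g using U U' b mat_diag_dim[of n "\<lambda>i. g (d i)"]
      by (simp add: assoc_mult_mat_vec[of _ n n _ n] mult_carrier_mat[of _ n n])
    then have "(matrix_fun g A *\<^sub>v b) \<bullet>c y = (?G *\<^sub>v (?U *\<^sub>v b)) \<bullet>c (?U *\<^sub>v y)"
      using cscalar_prod_adjoint[OF U, of "?G *\<^sub>v (?U *\<^sub>v b)" y] y b U'
        mat_diag_dim[of n "\<lambda>i. g (d i)"] by simp
    also have "\<dots> = (\<Sum>i<n. (?G *\<^sub>v (?U *\<^sub>v b)) $ i * cnj ((?U *\<^sub>v y) $ i))"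
      unfolding cscalar_prod_sum using U by simp
    also have "\<dots> = (\<Sum>i<n. ((?U *\<^sub>v b) $ i * cnj ((?U *\<^sub>v y) $ i)) * g (d i))"
    proof (intro sum.cong refl)
      fix i assume i: "i \<in> {..<n}"
      have "(?G *\<^sub>v (?U *\<^sub>v b)) $ i = (\<Sum>j<n. (if i = j then g (d j) else 0) * (?U *\<^sub>v b) $ j)"
        using i U by (auto simp: mat_diag_def scalar_prod_def lessThan_atLeast0 intro!: sum.cong)
      also have "\<dots> = g (d i) * (?U *\<^sub>v b) $ i"
        using i by (simp add: if_distrib[of "\<lambda>x. x * _"] cong: if_cong)
      finally show "(?G *\<^sub>v (?U *\<^sub>v b)) $ i * cnj ((?U *\<^sub>v y) $ i)
        = ((?U *\<^sub>v b) $ i * cnj ((?U *\<^sub>v y) $ i)) * g (d i)" by simp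
    qed
    finally show ?thesis .
  qed
  then show ?thesis using d
    by (intro exI[of _ "\<lambda>i. (?U *\<^sub>v b) $ i * cnj ((?U *\<^sub>v y) $ i)"] exI[of _ d]) auto
qed

lemma matrix_fun_shift:
  assumes "hermitian_mat n A"
  shows "matrix_fun (\<lambda>x. x - w) A = A - w \<cdot>\<^sub>m 1\<^sub>m n"
  using matrix_fun_diff[OF assms, of "\<lambda>x. x" "\<lambda>x. w"]
  by (simp add: matrix_fun_ident[OF assms] matrix_fun_const[OF assms])

text \<open>On the spectrum \<open>x - w\<close> and \<open>1 / (x - w)\<close> are reciprocal, so
  the functional calculus yields a two-sided inverse, and uniqueness of inverses identifies it with
  the one chosen by \<open>mat_inverse\<close>.\<close>

lemma shifted_inverse_eq_matrix_fun:
  assumes A: "hermitian_mat n A" and w: "w \<notin> spectrum A"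
  shows "shifted_inverse A w = matrix_fun (\<lambda>x. 1 / (x - w)) A"
proof -
  define X where "X = A - w \<cdot>\<^sub>m 1\<^sub>m n"
  define Y where "Y = matrix_fun (\<lambda>x. 1 / (x - w)) A"
  have X: "X = matrix_fun (\<lambda>x. x - w) A" by (simp add: X_def matrix_fun_shift[OF A])
  have c: "X \<in> carrier_mat n n" "Y \<in> carrier_mat n n"
    unfolding X Y_def by (rule matrix_fun_carrier[OF A])+
  have "X * Y = matrix_fun (\<lambda>x. 1) A" "Y * X = matrix_fun (\<lambda>x. 1) A"
    unfolding X Y_def matrix_fun_mult[OF A]
    by (rule matrix_fun_cong[OF A], use w in auto)+
  then have inv: "X * Y = 1\<^sub>m n" "Y * X = 1\<^sub>m n"
    by (auto simp: matrix_fun_const[OF A] intro!: eq_matI)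
  have dim: "dim_row A = n" using A by (auto simp: hermitian_mat_def)
  have "mat_inverse X \<noteq> None"
    using mat_inverse(1)[OF c(1), of "()"] inv c by (auto simp: Units_def ring_mat_simps)
  then obtain B where B: "mat_inverse X = Some B" by auto
  then have XB: "X * B = 1\<^sub>m n" and Bc: "B \<in> carrier_mat n n" using mat_inverse(2)[OF c(1)] by auto
  have "B = (Y * X) * B" using inv Bc by simp
  also have "\<dots> = Y * (X * B)" by (rule assoc_mult_mat[OF c(2,1) Bc])
  finally have "B = Y" using XB c by simp
  then show ?thesis using B by (simp add: shifted_inverse_def dim X_def Y_def)
qed

section \<open>The norm of a positive definite form that commutes with the matrix\<close>

lemma pos_def_quadratic_nonneg:
  assumes "pos_def_mat n M" "u \<in> carrier_vec n"
  shows "Re ((M *\<^sub>v u) \<bullet>c u) \<ge> 0"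
proof (cases "u = 0\<^sub>v n")
  case True
  then show ?thesis by simp
next
  case False
  then show ?thesis using assms by (auto simp: pos_def_mat_def less_imp_le)
qed

lemma hermitian_cscalar_prod:
  assumes "hermitian_mat n M" "u \<in> carrier_vec n" "v \<in> carrier_vec n"
  shows "(M *\<^sub>v u) \<bullet>c v = u \<bullet>c (M *\<^sub>v v)"
  using assms cscalar_prod_adjoint[of M n n u v] by (auto simp: hermitian_mat_def)

lemma induced_norm_Cauchy_Schwarz:
  assumes M: "pos_def_mat n M" and x: "x \<in> carrier_vec n" and y: "y \<in> carrier_vec n"
  shows "cmod ((M *\<^sub>v x) \<bullet>c y) \<le> induced_norm M x * induced_norm M y"
proof (cases "y = 0\<^sub>v n")
  case True
  then show ?thesis by (simp add: induced_norm_def)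
next
  case False
  have H: "hermitian_mat n M" using M by (simp add: pos_def_mat_def)
  then have Mc: "M \<in> carrier_mat n n" by (simp add: hermitian_mat_def)
  define B where "B u v = (M *\<^sub>v u) \<bullet>c v" for u v
  have cnjB: "cnj (B u v) = B v u" if "u \<in> carrier_vec n" "v \<in> carrier_vec n" for u v
    using hermitian_cscalar_prod[OF H that(2,1)] that Mc by (simp add: B_def cscalar_prod_cnj)
  have re: "B u u = of_real (Re (B u u))" if "u \<in> carrier_vec n" for u
    using cnjB[OF that that] by (simp add: complex_eq_iff)
  have pos: "Re (B y y) > 0" using M False y by (auto simp: pos_def_mat_def B_def)
  \<comment> \<open>The coefficient of the projection of \<open>x\<close> on \<open>y\<close>,
    orthogonal for the form of \<open>M\<close>; it minimises the quadratic form at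
    \<open>x - t y\<close>.\<close>
  define t where "t = B x y / B y y"
  have "B (x - t \<cdot>\<^sub>v y) (x - t \<cdot>\<^sub>v y) = B x x - cnj t * B x y - t * B y x + t * cnj t * B y y"
    using x y Mc unfolding B_def
    by (simp add: mult_minus_distrib_mat_vec[of _ n n] mult_mat_vec[of _ n n] cscalar_prod_diff_left
        cscalar_prod_diff_right cscalar_prod_smult_left cscalar_prod_smult_right algebra_simps)
  also have "t * cnj t * B y y = cnj t * B x y" using pos by (auto simp: t_def)
  also have "B x x - cnj t * B x y - t * B y x + cnj t * B x y = B x x - B x y * cnj (B x y) / B y y"
    by (simp add: t_def cnjB[OF x y])
  also have "\<dots> = of_real (Re (B x x) - (cmod (B x y))\<^sup>2 / Re (B y y))"
    using re[OF x] re[OF y] by (simp add: complex_norm_square flip: of_real_power)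
  finally have "Re (B (x - t \<cdot>\<^sub>v y) (x - t \<cdot>\<^sub>v y)) = Re (B x x) - (cmod (B x y))\<^sup>2 / Re (B y y)"
    by simp
  moreover have "Re (B (x - t \<cdot>\<^sub>v y) (x - t \<cdot>\<^sub>v y)) \<ge> 0"
    unfolding B_def by (rule pos_def_quadratic_nonneg[OF M]) (use x y in auto)
  ultimately have "(cmod (B x y))\<^sup>2 \<le> Re (B x x) * Re (B y y)"
    using pos by (simp add: pos_divide_le_eq)
  then have "cmod (B x y) \<le> sqrt (Re (B x x) * Re (B y y))" by (rule real_le_rsqrt)
  then show ?thesis by (simp add: B_def induced_norm_def real_sqrt_mult)
qed

lemma induced_norm_matrix_fun_le:
  assumes A: "hermitian_mat n A" and M: "pos_def_mat n M" and MA: "M * A = A * M"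
    and u: "u \<in> carrier_vec n" and C: "0 \<le> C" "\<And>x. x \<in> spectrum A \<Longrightarrow> cmod (h x) \<le> C"
  shows "induced_norm M (matrix_fun h A *\<^sub>v u) \<le> C * induced_norm M u"
proof -
  have Mc: "M \<in> carrier_mat n n" using M by (simp add: pos_def_mat_def hermitian_mat_def)
  note fc = matrix_fun_carrier[OF A]
  \<comment> \<open>The adjoint of g(A) is itself a function of \<open>A\<close>, hence passes
    through \<open>M\<close> and meets g(A). The form thus depends on g only through its squared
    modulus, and linearly in that, which lets squared moduli be added and subtracted.\<close>
  have quad: "(M *\<^sub>v (matrix_fun g A *\<^sub>v u)) \<bullet>c (matrix_fun g A *\<^sub>v u)
      = (M *\<^sub>v (matrix_fun (\<lambda>x. cnj (g x) * g x) A *\<^sub>v u)) \<bullet>c u" for g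
  proof -
    let ?G = "matrix_fun g A" and ?G' = "matrix_fun (\<lambda>x. cnj (g x)) A"
    have "(M *\<^sub>v (?G *\<^sub>v u)) \<bullet>c (?G *\<^sub>v u) = (?G' *\<^sub>v (M *\<^sub>v (?G *\<^sub>v u))) \<bullet>c u"
      using cscalar_prod_adjoint[OF fc[of "\<lambda>x. cnj (g x)"], of "M *\<^sub>v (?G *\<^sub>v u)" u]
        mult_mat_vec_carrier[OF Mc mult_mat_vec_carrier[OF fc u]] u
      by (simp add: matrix_fun_adjoint[OF A])
    also have "?G' *\<^sub>v (M *\<^sub>v (?G *\<^sub>v u)) = (?G' * M) *\<^sub>v (?G *\<^sub>v u)"
      by (rule assoc_mult_mat_vec[OF fc Mc mult_mat_vec_carrier[OF fc u], symmetric])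
    also have "?G' * M = M * ?G'" by (rule matrix_fun_commute[OF A Mc MA, symmetric])
    also have "(M * ?G') *\<^sub>v (?G *\<^sub>v u) = M *\<^sub>v (?G' *\<^sub>v (?G *\<^sub>v u))"
      by (rule assoc_mult_mat_vec[OF Mc fc mult_mat_vec_carrier[OF fc u]])
    also have "?G' *\<^sub>v (?G *\<^sub>v u) = (?G' * ?G) *\<^sub>v u"
      by (rule assoc_mult_mat_vec[OF fc fc u, symmetric])
    finally show ?thesis by (simp add: matrix_fun_mult[OF A])
  qed
  \<comment> \<open>\<open>C\<^sup>2 \<langle>u, u\<rangle> - \<langle>h(A)u, h(A)u\<rangle> = \<langle>r(A)u, r(A)u\<rangle>\<close> for the form of \<open>M\<close>, which commutes with \<open>A\<close>.\<close>
  define r where "r x = complex_of_real (sqrt (C\<^sup>2 - (cmod (h x))\<^sup>2))" for x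
  have "matrix_fun (\<lambda>x. cnj (r x) * r x) A = matrix_fun (\<lambda>x. of_real (C\<^sup>2) - cnj (h x) * h x) A"
  proof (rule matrix_fun_cong[OF A])
    fix x assume "x \<in> spectrum A"
    then have "(cmod (h x))\<^sup>2 \<le> C\<^sup>2" using C by (intro power_mono) auto
    then have "(sqrt (C\<^sup>2 - (cmod (h x))\<^sup>2))\<^sup>2 = C\<^sup>2 - (cmod (h x))\<^sup>2" by simp
    then have "cnj (r x) * r x = of_real (C\<^sup>2 - (cmod (h x))\<^sup>2)"
      unfolding r_def complex_cnj_complex_of_real of_real_mult[symmetric]
      by (metis power2_eq_square)
    also have "\<dots> = of_real (C\<^sup>2) - cnj (h x) * h x"
      unfolding of_real_diff complex_norm_square by (simp add: mult.commute)
    finally show "cnj (r x) * r x = of_real (C\<^sup>2) - cnj (h x) * h x" .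
  qed
  also have "\<dots> = of_real (C\<^sup>2) \<cdot>\<^sub>m 1\<^sub>m n - matrix_fun (\<lambda>x. cnj (h x) * h x) A"
    by (simp add: matrix_fun_diff[OF A] matrix_fun_const[OF A])
  finally have r2: "matrix_fun (\<lambda>x. cnj (r x) * r x) A *\<^sub>v u
      = of_real (C\<^sup>2) \<cdot>\<^sub>v u - matrix_fun (\<lambda>x. cnj (h x) * h x) A *\<^sub>v u"
    using fc u by (simp add: minus_mult_distrib_mat_vec[of _ n n] smult_one_mat_mult_vec)
  have "0 \<le> Re ((M *\<^sub>v (matrix_fun r A *\<^sub>v u)) \<bullet>c (matrix_fun r A *\<^sub>v u))"
    by (rule pos_def_quadratic_nonneg[OF M]) (use mult_mat_vec_carrier[OF fc u] in auto)
  also have "(M *\<^sub>v (matrix_fun r A *\<^sub>v u)) \<bullet>c (matrix_fun r A *\<^sub>v u)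
      = of_real (C\<^sup>2) * ((M *\<^sub>v u) \<bullet>c u) - (M *\<^sub>v (matrix_fun h A *\<^sub>v u)) \<bullet>c (matrix_fun h A *\<^sub>v u)"
    unfolding quad r2 using Mc u mult_mat_vec_carrier[OF fc u]
    by (simp add: mult_minus_distrib_mat_vec[of _ n n] mult_mat_vec[of _ n n] cscalar_prod_diff_left
        cscalar_prod_smult_left mult_mat_vec_carrier[of _ n n])
  finally have "Re ((M *\<^sub>v (matrix_fun h A *\<^sub>v u)) \<bullet>c (matrix_fun h A *\<^sub>v u)) \<le> C\<^sup>2 * Re ((M *\<^sub>v u) \<bullet>c u)"
    by (simp flip: of_real_power)
  then have "induced_norm M (matrix_fun h A *\<^sub>v u) \<le> sqrt (C\<^sup>2 * Re ((M *\<^sub>v u) \<bullet>c u))"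
    unfolding induced_norm_def by (rule real_sqrt_le_mono)
  then show ?thesis using C by (simp add: induced_norm_def real_sqrt_mult)
qed

section \<open>Contour integrals\<close>

text \<open>A valid path is continuous, but \<open>C\<^sup>1\<close> only off a finite set, so it may have infinite
  length. If the right-hand side is finite, the integrand is absolutely integrable and the gauge integral
  is a Lebesgue integral; \<open>C = 0\<close> is treated separately because \<open>0 * \<infinity> = 0\<close>.\<close>

lemma contour_integral_arc_length_bound:
  fixes F :: "complex \<Rightarrow> complex" and g :: "complex \<Rightarrow> ennreal"
  assumes vp: "valid_path \<gamma>" and cont: "continuous_on (path_image \<gamma>) F"
    and C: "0 \<le> C" and le: "\<And>z. z \<in> path_image \<gamma> \<Longrightarrow> ennreal (cmod (F z)) \<le> ennreal C * g z"
  shows "ennreal (cmod (contour_integral \<gamma> F)) \<le> ennreal C * arc_length_integral g \<gamma>"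
proof (cases "C = 0")
  case True
  then have "F z = 0" if "z \<in> path_image \<gamma>" for z using le[OF that] by simp
  then have "contour_integral \<gamma> F = contour_integral \<gamma> (\<lambda>z. 0)" by (rule contour_integral_eq)
  then show ?thesis by simp
next
  case False
  with C have C0: "C > 0" by simp
  obtain K where K: "finite K" "\<gamma> C1_differentiable_on ({0..1} - K)" and \<gamma>: "continuous_on {0..1} \<gamma>"
    using vp by (auto simp: valid_path_def piecewise_C1_differentiable_on_def)
  obtain D where D: "\<And>t. t \<in> {0..1} - K \<Longrightarrow> (\<gamma> has_vector_derivative D t) (at t)"
    and contD: "continuous_on ({0..1} - K) D"
    using K(2) unfolding C1_differentiable_on_def by blast
  \<comment> \<open>With the endpoints removed as well, \<open>E\<close> is open, which gives
    measurability, and on \<open>E\<close> the derivative within the interval agrees with the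
    two-sided one used by the contour integral.\<close>
  define E where "E = {0<..<1} - K"
  define \<phi> where "\<phi> t = F (\<gamma> t) * vector_derivative \<gamma> (at t within {0..1})" for t
  have "open E" unfolding E_def using K(1) by (intro open_Diff finite_imp_closed) auto
  have vd: "vector_derivative \<gamma> (at t within {0..1}) = D t" if "t \<in> E" for t
    using that D[of t] unfolding E_def
    by (intro vector_derivative_at_within_ivl) auto
  have "continuous_on E (\<lambda>t. F (\<gamma> t) * D t)"
  proof (intro continuous_intros)
    show "continuous_on E D" by (rule continuous_on_subset[OF contD]) (auto simp: E_def)
    show "continuous_on E (\<lambda>t. F (\<gamma> t))"
      by (rule continuous_on_compose2[OF cont])
         (auto simp: E_def path_image_def intro: continuous_on_subset[OF \<gamma>])
  qed
  then have "continuous_on E \<phi>" by (rule continuous_on_eq) (simp add: \<phi>_def vd)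
  then have meas: "(\<lambda>t. indicator E t *\<^sub>R \<phi> t) \<in> borel_measurable borel"
    using \<open>open E\<close> by (intro borel_measurable_continuous_on_indicator) auto
  define I where "I = (\<integral>\<^sup>+t. ennreal (cmod (indicator E t *\<^sub>R \<phi> t)) \<partial>lborel)"
  \<comment> \<open>\<open>g\<close> is not assumed measurable, so \<open>C\<close> cannot be pulled
    out of an integral of \<open>g\<close>. Its reciprocal is moved into the measurable integrand
    instead, and the comparison with \<open>g\<close> is pure monotonicity.\<close>
  have "ennreal (1 / C) * I = (\<integral>\<^sup>+t. ennreal (1 / C) * ennreal (cmod (indicator E t *\<^sub>R \<phi> t)) \<partial>lborel)"
    unfolding I_def
    by (rule nn_integral_cmult[symmetric])
       (use measurable_compose[OF measurable_compose[OF meas borel_measurable_norm] measurable_ennreal] in simp)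
  also have "\<dots> \<le> arc_length_integral g \<gamma>"
    unfolding arc_length_integral_def
  proof (rule nn_integral_mono)
    fix t :: real
    show "ennreal (1 / C) * ennreal (cmod (indicator E t *\<^sub>R \<phi> t))
      \<le> g (\<gamma> t) * ennreal (cmod (vector_derivative \<gamma> (at t within {0..1}))) * indicator {0..1} t"
    proof (cases "t \<in> E")
      case True
      then have t: "t \<in> {0..1}" by (auto simp: E_def)
      have "ennreal (1 / C) * ennreal (cmod (F (\<gamma> t))) \<le> ennreal (1 / C) * (ennreal C * g (\<gamma> t))"
        using t by (intro mult_left_mono le) (auto simp: path_image_def)
      also have "\<dots> = g (\<gamma> t)"
        using C0 by (simp add: mult.assoc[symmetric] ennreal_mult[symmetric])
      finally have "ennreal (1 / C) * ennreal (cmod (F (\<gamma> t))) * ennreal (cmod (vector_derivative \<gamma> (at t within {0..1})))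
        \<le> g (\<gamma> t) * ennreal (cmod (vector_derivative \<gamma> (at t within {0..1})))"
        by (intro mult_right_mono) auto
      then show ?thesis using True t by (simp add: \<phi>_def norm_mult ennreal_mult mult.assoc)
    qed simp
  qed
  finally have "ennreal C * (ennreal (1 / C) * I) \<le> ennreal C * arc_length_integral g \<gamma>"
    by (intro mult_left_mono) auto
  then have I: "I \<le> ennreal C * arc_length_integral g \<gamma>"
    using C0 by (simp add: mult.assoc[symmetric] ennreal_mult[symmetric])
  have "ennreal (cmod (contour_integral \<gamma> F)) \<le> I"
  proof (cases "I = \<infinity>")
    case False
    then have int: "set_integrable lborel E \<phi>"
      unfolding set_integrable_def using meas
      by (intro integrableI_bounded) (auto simp: I_def top.not_eq_extremum less_top)
    let ?\<psi> = "\<lambda>t. F (\<gamma> t) * vector_derivative \<gamma> (at t)"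
    have "contour_integral \<gamma> F = integral {0..1} ?\<psi>"
      by (rule contour_integral_integral)
    also have "\<dots> = integral E ?\<psi>"
    proof (rule integral_spike_set)
      show "negligible {x \<in> {0..1} - E. ?\<psi> x \<noteq> 0}"
        by (rule negligible_finite, rule finite_subset[of _ "insert 0 (insert 1 K)"])
           (use K in \<open>auto simp: E_def\<close>)
      show "negligible {x \<in> E - {0..1}. ?\<psi> x \<noteq> 0}"
        by (rule negligible_subset[of "{}"]) (auto simp: E_def)
    qed
    also have "\<dots> = integral E \<phi>"
      by (rule integral_cong) (use D in \<open>auto simp: \<phi>_def vd E_def vector_derivative_at\<close>)
    also have "\<dots> = (LINT t|lborel. indicator E t *\<^sub>R \<phi> t)"
      using set_borel_integral_eq_integral(2)[OF int] by (simp add: set_lebesgue_integral_def)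
    finally show ?thesis
      using integral_norm_bound_ennreal[OF int[unfolded set_integrable_def]] by (simp add: I_def)
  qed simp
  with I show ?thesis by (rule order_trans[rotated])
qed

text \<open>Cauchy's formula is applied to each curve separately: a point outside \<open>N\<close>
  lies outside every curve and so has winding number 0. After division by the orientation each node
  has total weight 1, since exactly one curve encloses it. The sum of \<open>c i / (p i - z)\<close>
  is the same functional evaluated at the resolvent function instead of f.\<close>

lemma enclosed_sum_contour_bound:
  fixes f :: "complex \<Rightarrow> complex" and p c :: "'i \<Rightarrow> complex"
  assumes I: "finite I" and N: "open N" "f holomorphic_on N" and G: "finite \<Gamma>"
    and path: "\<And>\<gamma>. \<gamma> \<in> \<Gamma> \<Longrightarrow> valid_path \<gamma> \<and> simple_path \<gamma> \<and> pathfinish \<gamma> = pathstart \<gamma>"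
    and sub: "\<And>\<gamma>. \<gamma> \<in> \<Gamma> \<Longrightarrow> path_image \<gamma> \<union> inside (path_image \<gamma>) \<subseteq> N"
    and p: "\<And>i. i \<in> I \<Longrightarrow> p i \<in> N"
    and encl: "\<And>i. i \<in> I \<Longrightarrow> (\<forall>\<gamma>\<in>\<Gamma>. p i \<notin> path_image \<gamma>) \<and> (\<exists>!\<gamma>. \<gamma> \<in> \<Gamma> \<and> p i \<in> inside (path_image \<gamma>))"
  shows "cmod (\<Sum>i\<in>I. c i * f (p i))
    \<le> 1 / (2 * pi) * (\<Sum>\<gamma>\<in>\<Gamma>. cmod (contour_integral \<gamma> (\<lambda>z. f z * (\<Sum>i\<in>I. c i / (p i - z)))))"
proof -
  have "\<exists>s. cmod s = 1 \<and> (\<forall>z\<in>inside (path_image \<gamma>). winding_number \<gamma> z = s)" if "\<gamma> \<in> \<Gamma>" for \<gamma>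
  proof -
    from path[OF that] have "simple_path \<gamma>" by auto
    then show ?thesis
    proof (cases rule: simple_closed_path_winding_number_inside)
      case 1
      then show ?thesis by (intro exI[of _ 1]) auto
    next
      case 2
      then show ?thesis by (intro exI[of _ "- 1"]) auto
    qed
  qed
  \<comment> \<open>The orientation of each curve is unknown, and the sign \<open>s\<close> compensates for it.\<close>
  then obtain s where s: "\<And>\<gamma>. \<gamma> \<in> \<Gamma> \<Longrightarrow> cmod (s \<gamma>) = 1"
    "\<And>\<gamma> z. \<gamma> \<in> \<Gamma> \<Longrightarrow> z \<in> inside (path_image \<gamma>) \<Longrightarrow> winding_number \<gamma> z = s \<gamma>"
    by metis
  have out: "winding_number \<gamma> z = 0" if "\<gamma> \<in> \<Gamma>" "z \<notin> path_image \<gamma>" "z \<notin> inside (path_image \<gamma>)" for \<gamma> z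
  proof (rule winding_number_zero_in_outside)
    show "z \<in> outside (path_image \<gamma>)" using that by (simp add: outside_inside)
  qed (use path[OF that(1)] in \<open>auto simp: simple_path_def\<close>)
  have wsum: "(\<Sum>\<gamma>\<in>\<Gamma>. winding_number \<gamma> (p i) / s \<gamma>) = 1" if i: "i \<in> I" for i
  proof -
    from encl[OF i] obtain \<gamma>0 where \<gamma>0: "\<gamma>0 \<in> \<Gamma>" "p i \<in> inside (path_image \<gamma>0)"
      and uniq: "\<And>\<gamma>. \<gamma> \<in> \<Gamma> \<Longrightarrow> p i \<in> inside (path_image \<gamma>) \<Longrightarrow> \<gamma> = \<gamma>0" by blast
    have "(\<Sum>\<gamma>\<in>\<Gamma>. winding_number \<gamma> (p i) / s \<gamma>) = (\<Sum>\<gamma>\<in>\<Gamma>. if \<gamma> = \<gamma>0 then 1 else 0)"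
    proof (intro sum.cong refl)
      fix \<gamma> assume g: "\<gamma> \<in> \<Gamma>"
      have "s \<gamma> \<noteq> 0" using s(1)[OF g] by auto
      then show "winding_number \<gamma> (p i) / s \<gamma> = (if \<gamma> = \<gamma>0 then 1 else 0)"
        using s(2)[OF \<gamma>0] out[OF g, of "p i"] encl[OF i] uniq[OF g] g by auto
    qed
    then show ?thesis using G \<gamma>0 by simp
  qed
  define K where "K = complex_of_real (2 * pi) * \<i>"
  have K: "K \<noteq> 0" "cmod K = 2 * pi" by (auto simp: K_def norm_mult)
  let ?F = "\<lambda>z. f z * (\<Sum>i\<in>I. c i / (p i - z))"
  have ci: "((\<lambda>z. f z * (\<Sum>i\<in>I. c i / (p i - z))) has_contour_integral
      (\<Sum>i\<in>I. - c i * (K * winding_number \<gamma> (p i) * f (p i)))) \<gamma>" if g: "\<gamma> \<in> \<Gamma>" for \<gamma>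
  proof -
    have "((\<lambda>z. \<Sum>i\<in>I. - c i * (f z / (z - p i))) has_contour_integral
      (\<Sum>i\<in>I. - c i * (K * winding_number \<gamma> (p i) * f (p i)))) \<gamma>"
    unfolding K_def
    proof (intro has_contour_integral_sum I has_contour_integral_lmul Cauchy_integral_formula_global[OF N])
      fix i assume i: "i \<in> I"
      show "path_image \<gamma> \<subseteq> N - {p i}" using sub[OF g] encl[OF i] g by auto
      show "winding_number \<gamma> z = 0" if "z \<notin> N" for z
        using out[OF g] sub[OF g] that by auto
    qed (use path[OF g] p in auto)
    moreover have "(\<lambda>z. \<Sum>i\<in>I. - c i * (f z / (z - p i))) = (\<lambda>z. f z * (\<Sum>i\<in>I. c i / (p i - z)))"
    proof
      fix z
      \<comment> \<open>At \<open>z = p i\<close> both sides are 0 by the convention for division by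
        zero, so the two integrands agree at every point.\<close>
      have "- c i * (f z / (z - p i)) = f z * (c i / (p i - z))" for i
        by (metis (no_types, opaque_lifting) minus_diff_eq minus_divide_right mult.commute
            mult_minus_left times_divide_eq_left times_divide_eq_right)
      then show "(\<Sum>i\<in>I. - c i * (f z / (z - p i))) = f z * (\<Sum>i\<in>I. c i / (p i - z))"
        by (simp add: sum_distrib_left)
    qed
    ultimately show ?thesis by simp
  qed
  have "(\<Sum>i\<in>I. c i * f (p i)) = (\<Sum>i\<in>I. c i * f (p i) * (\<Sum>\<gamma>\<in>\<Gamma>. winding_number \<gamma> (p i) / s \<gamma>))"
    using wsum by simp
  also have "\<dots> = (\<Sum>i\<in>I. \<Sum>\<gamma>\<in>\<Gamma>. c i * f (p i) * (winding_number \<gamma> (p i) / s \<gamma>))"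
    by (simp add: sum_distrib_left)
  also have "\<dots> = (\<Sum>\<gamma>\<in>\<Gamma>. \<Sum>i\<in>I. c i * f (p i) * (winding_number \<gamma> (p i) / s \<gamma>))"
    by (rule sum.swap)
  \<comment> \<open>The minus sign stems from the denominators \<open>p i - z\<close>, which are
    opposite to those of Cauchy's formula.\<close>
  also have "\<dots> = (\<Sum>\<gamma>\<in>\<Gamma>. - (1 / (K * s \<gamma>)) * contour_integral \<gamma> ?F)"
  proof (intro sum.cong refl)
    fix \<gamma> assume g: "\<gamma> \<in> \<Gamma>"
    have "s \<gamma> \<noteq> 0" using s(1)[OF g] by auto
    then have "c i * f (p i) * (winding_number \<gamma> (p i) / s \<gamma>)
        = - (1 / (K * s \<gamma>)) * (- c i * (K * winding_number \<gamma> (p i) * f (p i)))" for i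
      using K by (simp add: divide_simps)
    then show "(\<Sum>i\<in>I. c i * f (p i) * (winding_number \<gamma> (p i) / s \<gamma>))
      = - (1 / (K * s \<gamma>)) * contour_integral \<gamma> ?F"
      unfolding contour_integral_unique[OF ci[OF g]] by (simp only: sum_distrib_left)
  qed
  also have "cmod \<dots> \<le> (\<Sum>\<gamma>\<in>\<Gamma>. cmod (- (1 / (K * s \<gamma>)) * contour_integral \<gamma> ?F))"
    by (rule norm_sum)
  also have "\<dots> = (\<Sum>\<gamma>\<in>\<Gamma>. 1 / (2 * pi) * cmod (contour_integral \<gamma> ?F))"
    by (intro sum.cong refl) (simp add: norm_mult norm_divide s(1) K)
  also have "\<dots> = 1 / (2 * pi) * (\<Sum>\<gamma>\<in>\<Gamma>. cmod (contour_integral \<gamma> ?F))"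
    by (rule sum_distrib_left[symmetric])
  finally show ?thesis .
qed

section \<open>The Lanczos error\<close>

lemma lanczos_q_Suc_eq: "snd (snd (lanczos_state A b j)) = lanczos_q A b (Suc j)"
  by (simp add: lanczos_q_def Let_def split: prod.split)

lemma lanczos_q_0: "lanczos_q A b 0 = 0\<^sub>v (dim_row A)"
  by (simp add: lanczos_q_def)

lemma lanczos_q_1: "lanczos_q A b (Suc 0) = complex_of_real (1 / norm2_vec b) \<cdot>\<^sub>v b"
  by (simp add: lanczos_q_def Let_def)

lemma lanczos_beta_0: "lanczos_beta A b 0 = 0"
  by (simp add: lanczos_beta_def)

text \<open>The next Lanczos vector before normalisation, written with the finished quantities of
  step j rather than with the recursion on triples.\<close>

definition lanczos_residual :: "complex mat \<Rightarrow> complex Matrix.vec \<Rightarrow> nat \<Rightarrow> complex Matrix.vec" where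
  "lanczos_residual A b j =
     A *\<^sub>v lanczos_q A b j - complex_of_real (lanczos_beta A b (j - 1)) \<cdot>\<^sub>v lanczos_q A b (j - 1)
       - lanczos_alpha A b j \<cdot>\<^sub>v lanczos_q A b j"

text \<open>Unpacks the recursion on triples. Together with the initial values, these two equations
  carry all later arguments about the Lanczos vectors.\<close>

lemma lanczos_step:
  assumes "j \<ge> 1"
  shows "lanczos_beta A b j = norm2_vec (lanczos_residual A b j)"
    and "lanczos_q A b (Suc j) = complex_of_real (1 / lanczos_beta A b j) \<cdot>\<^sub>v lanczos_residual A b j"
proof -
  obtain i where j: "j = Suc i" using assms by (cases j) auto
  have st: "lanczos_state A b i = (lanczos_q A b i, lanczos_beta A b i, lanczos_q A b (Suc i))"
    by (auto simp: lanczos_q_Suc_eq[symmetric] prod_eq_iff) (auto simp: lanczos_q_def lanczos_beta_def)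
  have st': "lanczos_state A b (Suc i) = (lanczos_q A b (Suc i), norm2_vec (lanczos_residual A b j),
      complex_of_real (1 / norm2_vec (lanczos_residual A b j)) \<cdot>\<^sub>v lanczos_residual A b j)"
    unfolding lanczos_state.simps(2) st
    by (simp add: Let_def lanczos_residual_def lanczos_alpha_def j)
  show beta: "lanczos_beta A b j = norm2_vec (lanczos_residual A b j)"
    unfolding lanczos_beta_def j st' by (simp add: j)
  show "lanczos_q A b (Suc j) = complex_of_real (1 / lanczos_beta A b j) \<cdot>\<^sub>v lanczos_residual A b j"
    unfolding lanczos_q_Suc_eq[symmetric] j st' using beta by (simp add: j)
qed

section \<open>Recurrence and orthonormality of the Lanczos vectors\<close>

context
  fixes A :: "complex mat" and b :: "complex Matrix.vec" and n k :: nat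
  assumes A: "hermitian_mat n A" and b: "b \<in> carrier_vec n"
    and nb: "lanczos_no_breakdown A b k"
begin

private abbreviation (input) "q \<equiv> lanczos_q A b"
private abbreviation (input) "\<beta> j \<equiv> complex_of_real (lanczos_beta A b j)"
private abbreviation (input) "\<alpha> \<equiv> lanczos_alpha A b"

lemma lanczos_A_carrier: "A \<in> carrier_mat n n" and lanczos_A_dim [simp]: "dim_row A = n" "dim_col A = n"
  using A by (auto simp: hermitian_mat_def)

lemma lanczos_q_carrier: "q j \<in> carrier_vec n"
proof (induction j rule: less_induct)
  case (less j)
  show ?case
  proof (cases j)
    case 0
    then show ?thesis by (simp add: lanczos_q_0)
  next
    case (Suc i)
    show ?thesis
    proof (cases "i = 0")
      case True
      then show ?thesis using Suc b by (simp add: lanczos_q_1)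
    next
      case False
      have "lanczos_residual A b i \<in> carrier_vec n"
        unfolding lanczos_residual_def using less[of i] less[of "i - 1"] Suc lanczos_A_carrier by auto
      then show ?thesis using Suc False by (simp add: lanczos_step(2))
    qed
  qed
qed

lemma lanczos_q_dim [simp]: "dim_vec (q j) = n"
  using lanczos_q_carrier by auto

lemma lanczos_residual_carrier: "lanczos_residual A b j \<in> carrier_vec n"
  unfolding lanczos_residual_def using lanczos_q_carrier lanczos_A_carrier by auto

text \<open>This survives \<beta>_j = 0: a residual of norm 0 is the zero vector. The last step j =
  k, whose divisor \<open>lanczos_no_breakdown\<close> leaves unrestricted, is therefore
  covered.\<close>

lemma lanczos_residual_eq:
  assumes "j \<ge> 1"
  shows "lanczos_residual A b j = \<beta> j \<cdot>\<^sub>v q (Suc j)"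
proof (cases "lanczos_beta A b j = 0")
  case True
  then have "lanczos_residual A b j = 0\<^sub>v n"
    using lanczos_step(1)[OF assms, of A b] norm2_vec_eq_0[OF lanczos_residual_carrier] by simp
  then show ?thesis using True lanczos_q_carrier by auto
next
  case False
  then show ?thesis
    using lanczos_step(2)[OF assms, of A b] by (simp add: smult_smult_assoc)
qed

lemma lanczos_recurrence:
  assumes "j \<ge> 1"
  shows "A *\<^sub>v q j = \<beta> (j - 1) \<cdot>\<^sub>v q (j - 1) + \<alpha> j \<cdot>\<^sub>v q j + \<beta> j \<cdot>\<^sub>v q (Suc j)"
  using lanczos_residual_eq[OF assms, symmetric] lanczos_A_carrier
  by (intro eq_vecI) (auto simp: lanczos_residual_def)

text \<open>Induction on the number of vectors. Against the latest vector, orthogonality is the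
  choice of \<alpha>. Against an earlier q_j, self-adjointness moves \<open>A\<close> onto q_j,
  whose recurrence reaches only to q_(j+1); a term survives only for j = m - 1, where it cancels the
  subtracted multiple of q_(m-1).\<close>

lemma lanczos_orthonormal:
  assumes "1 \<le> i" "i \<le> k" "1 \<le> j" "j \<le> k"
  shows "q i \<bullet>c q j = (if i = j then 1 else 0)"
proof -
  have "\<forall>i j. 1 \<le> i \<and> i \<le> m \<and> 1 \<le> j \<and> j \<le> m \<longrightarrow> q i \<bullet>c q j = (if i = j then 1 else 0)"
    if "m \<le> k" for m
    using that
  proof (induction m)
    case 0
    then show ?case by auto
  next
    case (Suc m)
    then have IH: "\<And>i j. 1 \<le> i \<Longrightarrow> i \<le> m \<Longrightarrow> 1 \<le> j \<Longrightarrow> j \<le> m \<Longrightarrow> q i \<bullet>c q j = (if i = j then 1 else 0)"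
      by auto
    have new: "q (Suc m) \<bullet>c q (Suc m) = 1 \<and> (\<forall>j. 1 \<le> j \<and> j \<le> m \<longrightarrow> q (Suc m) \<bullet>c q j = 0)"
    proof (cases "m = 0")
      case True
      have "norm2_vec b \<noteq> 0" using nb by (simp add: lanczos_no_breakdown_def)
      then show ?thesis using True
        by (simp add: lanczos_q_1 cscalar_prod_smult_left cscalar_prod_smult_right)
           (simp add: cscalar_prod_self power2_eq_square)
    next
      case False
      then have m: "m \<ge> 1" by simp
      have \<beta>0: "lanczos_beta A b m \<noteq> 0"
        using nb Suc.prems m by (auto simp: lanczos_no_breakdown_def)
      have res: "q (Suc m) = complex_of_real (1 / lanczos_beta A b m) \<cdot>\<^sub>v lanczos_residual A b m"
        by (rule lanczos_step(2)[OF m])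
      have rd: "dim_vec (lanczos_residual A b m) = n" using lanczos_residual_carrier by auto
      have "q (Suc m) \<bullet>c q (Suc m) = 1"
        unfolding res using \<beta>0 rd lanczos_step(1)[OF m, of A b]
        by (simp add: cscalar_prod_smult_left cscalar_prod_smult_right)
           (simp add: cscalar_prod_self power2_eq_square)
      moreover have "q (Suc m) \<bullet>c q j = 0" if j: "1 \<le> j" "j \<le> m" for j
      proof -
        have "lanczos_residual A b m \<bullet>c q j
          = (A *\<^sub>v q m) \<bullet>c q j - \<beta> (m - 1) * (q (m - 1) \<bullet>c q j) - \<alpha> m * (q m \<bullet>c q j)"
          unfolding lanczos_residual_def using lanczos_A_carrier
          by (simp add: cscalar_prod_diff_left cscalar_prod_smult_left)
        also have "\<dots> = 0"
        proof (cases "j = m")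
          case True
          have "q m \<bullet>c q m = 1" using IH[of m m] m by simp
          then show ?thesis
            unfolding True using lanczos_A_carrier
            by (simp add: lanczos_alpha_def cscalar_prod_diff_left cscalar_prod_smult_left)
        next
          case False
          with j have jm: "j < m" by simp
          have qmj: "q m \<bullet>c q j = 0" using IH[of m j] j jm m by simp
          \<comment> \<open>For j = 1 the predecessor is the artificial vector q_0 = 0, which the
            induction hypothesis does not cover.\<close>
          have q0: "q m \<bullet>c q (j - 1) = 0"
          proof (cases "j = 1")
            case True
            then show ?thesis by (simp add: lanczos_q_0)
          next
            case False
            then show ?thesis using IH[of m "j - 1"] j jm m by simp
          qed
          have "(A *\<^sub>v q m) \<bullet>c q j = q m \<bullet>c (A *\<^sub>v q j)"
            by (rule hermitian_cscalar_prod[OF A lanczos_q_carrier lanczos_q_carrier])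
          also have "\<dots> = \<beta> j * (q m \<bullet>c q (Suc j))"
            unfolding lanczos_recurrence[OF j(1)]
            by (simp add: cscalar_prod_add_right cscalar_prod_smult_right qmj q0[unfolded One_nat_def])
          finally have Aq: "(A *\<^sub>v q m) \<bullet>c q j = \<beta> j * (q m \<bullet>c q (Suc j))" .
          show ?thesis
          proof (cases "Suc j = m")
            case True
            then have "q m \<bullet>c q (Suc j) = 1" "q (m - 1) \<bullet>c q j = 1"
              using IH[of m m] IH[of j j] m j jm by auto
            then show ?thesis using Aq qmj True by auto
          next
            case False
            then have "q m \<bullet>c q (Suc j) = 0" "q (m - 1) \<bullet>c q j = 0"
              using IH[of m "Suc j"] IH[of "m - 1" j] m j jm by auto
            then show ?thesis using Aq qmj by simp
          qed
        qed
        finally show ?thesis unfolding res using rd by (simp add: cscalar_prod_smult_left)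
      qed
      ultimately show ?thesis by blast
    qed
    have new': "q j \<bullet>c q (Suc m) = 0" if "1 \<le> j" "j \<le> m" for j
      using new that cscalar_prod_cnj[of "q (Suc m)" "q j"] by simp
    show ?case using new new' IH by (auto simp: le_Suc_eq)
  qed
  then show ?thesis using assms by blast
qed

text \<open>Orthogonality removes the \<beta> term from the definition (for j = 1 its coefficient is
  already 0), and what remains is a quadratic form of the Hermitian matrix \<open>A\<close>.\<close>

lemma lanczos_alpha_real:
  assumes "1 \<le> j" "j \<le> k"
  shows "cnj (\<alpha> j) = \<alpha> j"
proof -
  have q0: "\<beta> (j - 1) * (q (j - 1) \<bullet>c q j) = 0"
    using lanczos_orthonormal[of "j - 1" j] assms by (cases "j = 1") (auto simp: lanczos_beta_0)
  then have "\<alpha> j = (A *\<^sub>v q j) \<bullet>c q j"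
    using lanczos_A_carrier by (simp add: lanczos_alpha_def cscalar_prod_diff_left cscalar_prod_smult_left)
  moreover have "cnj ((A *\<^sub>v q j) \<bullet>c q j) = (A *\<^sub>v q j) \<bullet>c q j"
    using hermitian_cscalar_prod[OF A lanczos_q_carrier lanczos_q_carrier, of j j]
    by (simp add: cscalar_prod_cnj)
  ultimately show ?thesis by simp
qed

section \<open>The matrices T and Q and the Lanczos relation\<close>

lemma lanczos_T_carrier: "lanczos_T A b k \<in> carrier_mat k k"
  by (simp add: lanczos_T_def)

lemma lanczos_T_hermitian: "hermitian_mat k (lanczos_T A b k)"
  unfolding hermitian_mat_def
proof (intro conjI lanczos_T_carrier eq_matI)
  fix i j assume "i < dim_row (lanczos_T A b k)" "j < dim_col (lanczos_T A b k)"
  then have ij: "i < k" "j < k" by (auto simp: lanczos_T_def)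
  then show "mat_adjoint (lanczos_T A b k) $$ (i, j) = lanczos_T A b k $$ (i, j)"
    by (auto simp: lanczos_T_def lanczos_alpha_real)
qed (auto simp: lanczos_T_def)

lemma lanczos_Q_carrier: "lanczos_Q A b k \<in> carrier_mat n k"
  using mat_of_cols_carrier(1)[of n "map q [1..<Suc k]"] by (simp add: lanczos_Q_def del: upt_Suc)

lemma lanczos_Q_index: "i < n \<Longrightarrow> j < k \<Longrightarrow> lanczos_Q A b k $$ (i, j) = q (Suc j) $ i"
  by (simp add: lanczos_Q_def mat_of_cols_index del: upt_Suc)

lemma lanczos_Q_mult_vec:
  assumes "x \<in> carrier_vec k" "i < n"
  shows "(lanczos_Q A b k *\<^sub>v x) $ i = (\<Sum>j<k. x $ j * q (Suc j) $ i)"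
  using assms lanczos_Q_carrier
  by (auto simp: scalar_prod_def lanczos_Q_index lessThan_atLeast0 mult.commute intro!: sum.cong)

lemma lanczos_Q_adjoint_b:
  assumes "k \<ge> 1"
  shows "mat_adjoint (lanczos_Q A b k) *\<^sub>v b = complex_of_real (norm2_vec b) \<cdot>\<^sub>v unit_vec k 0"
proof (rule eq_vecI)
  have nb0: "norm2_vec b \<noteq> 0" using nb by (simp add: lanczos_no_breakdown_def)
  have bq: "b = complex_of_real (norm2_vec b) \<cdot>\<^sub>v q (Suc 0)"
    using nb0 by (simp add: lanczos_q_1 smult_smult_assoc)
  fix j assume "j < dim_vec (complex_of_real (norm2_vec b) \<cdot>\<^sub>v unit_vec k 0)"
  then have j: "j < k" by simp
  have "(mat_adjoint (lanczos_Q A b k) *\<^sub>v b) $ j = (\<Sum>i<n. cnj (q (Suc j) $ i) * b $ i)"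
    using j lanczos_Q_carrier b
    by (auto simp: scalar_prod_def lanczos_Q_index lessThan_atLeast0 intro!: sum.cong)
  also have "\<dots> = b \<bullet>c q (Suc j)"
    by (simp add: cscalar_prod_sum mult.commute)
  also have "\<dots> = complex_of_real (norm2_vec b) * (q (Suc 0) \<bullet>c q (Suc j))"
    by (subst bq) (simp add: cscalar_prod_smult_left)
  also have "q (Suc 0) \<bullet>c q (Suc j) = (if j = 0 then 1 else 0)"
    using lanczos_orthonormal[of "Suc 0" "Suc j"] j by simp
  finally show "(mat_adjoint (lanczos_Q A b k) *\<^sub>v b) $ j
    = (complex_of_real (norm2_vec b) \<cdot>\<^sub>v unit_vec k 0) $ j" using j by auto
qed (use lanczos_Q_carrier in auto)

text \<open>Column \<open>j\<close> belongs to the vector q_(j+1), so this is the three-term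
  recurrence for it. At \<open>j = 0\<close> the first term is harmless because \<beta>_0 = 0; in
  the last column the term with q_(k+1) is missing, and it reappears as the rank-one correction in
  \<open>lanczos_AQ\<close>.\<close>

lemma lanczos_T_column_sum:
  assumes j: "j < k" and i: "i < n"
  shows "(\<Sum>m<k. lanczos_T A b k $$ (m, j) * q (Suc m) $ i)
    = \<beta> j * q j $ i + \<alpha> (Suc j) * q (Suc j) $ i + (if Suc j < k then \<beta> (Suc j) * q (Suc (Suc j)) $ i else 0)"
proof -
  have "(\<Sum>m<k. lanczos_T A b k $$ (m, j) * q (Suc m) $ i)
    = (\<Sum>m<k. (if Suc m = j then \<beta> j * q j $ i else 0) + (if m = j then \<alpha> (Suc j) * q (Suc j) $ i else 0)
         + (if m = Suc j then \<beta> (Suc j) * q (Suc (Suc j)) $ i else 0))"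
    using j by (intro sum.cong refl) (auto simp: lanczos_T_def)
  also have "\<dots> = (\<Sum>m<k. if Suc m = j then \<beta> j * q j $ i else 0) + \<alpha> (Suc j) * q (Suc j) $ i
      + (if Suc j < k then \<beta> (Suc j) * q (Suc (Suc j)) $ i else 0)"
    using j by (simp add: sum.distrib)
  also have "(\<Sum>m<k. if Suc m = j then \<beta> j * q j $ i else 0) = \<beta> j * q j $ i"
    using j by (cases j) (auto simp: lanczos_beta_0)
  finally show ?thesis .
qed

lemma lanczos_AQ:
  assumes x: "x \<in> carrier_vec k" and k: "k \<ge> 1"
  shows "A *\<^sub>v (lanczos_Q A b k *\<^sub>v x)
    = lanczos_Q A b k *\<^sub>v (lanczos_T A b k *\<^sub>v x) + (\<beta> k * x $ (k - 1)) \<cdot>\<^sub>v q (Suc k)"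
proof (rule eq_vecI)
  fix i assume "i < dim_vec (lanczos_Q A b k *\<^sub>v (lanczos_T A b k *\<^sub>v x) + (\<beta> k * x $ (k - 1)) \<cdot>\<^sub>v q (Suc k))"
  then have i: "i < n" by simp
  have Qx: "lanczos_Q A b k *\<^sub>v x \<in> carrier_vec n"
    by (rule mult_mat_vec_carrier[OF lanczos_Q_carrier x])
  have Aq: "(A *\<^sub>v q (Suc j)) $ i = \<beta> j * q j $ i + \<alpha> (Suc j) * q (Suc j) $ i + \<beta> (Suc j) * q (Suc (Suc j)) $ i" for j
    using lanczos_recurrence[of "Suc j"] i by simp
  have "(A *\<^sub>v (lanczos_Q A b k *\<^sub>v x)) $ i = (\<Sum>l<n. A $$ (i, l) * (lanczos_Q A b k *\<^sub>v x) $ l)"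
    by (rule mult_mat_vec_index[OF lanczos_A_carrier Qx i])
  also have "\<dots> = (\<Sum>l<n. \<Sum>j<k. A $$ (i, l) * (x $ j * q (Suc j) $ l))"
    by (intro sum.cong refl) (simp add: lanczos_Q_mult_vec[OF x] sum_distrib_left del: index_mult_mat_vec)
  also have "\<dots> = (\<Sum>j<k. \<Sum>l<n. A $$ (i, l) * (x $ j * q (Suc j) $ l))"
    by (rule sum.swap)
  also have "\<dots> = (\<Sum>j<k. x $ j * (A *\<^sub>v q (Suc j)) $ i)"
    using i by (intro sum.cong refl) (auto simp: scalar_prod_def lessThan_atLeast0 sum_distrib_left intro!: sum.cong)
  also have "\<dots> = (\<Sum>j<k. x $ j * (\<Sum>m<k. lanczos_T A b k $$ (m, j) * q (Suc m) $ i)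
      + (if j = k - 1 then \<beta> k * x $ (k - 1) * q (Suc k) $ i else 0))"
  proof (intro sum.cong refl)
    fix j assume "j \<in> {..<k}"
    then have j: "j < k" by simp
    show "x $ j * (A *\<^sub>v q (Suc j)) $ i = x $ j * (\<Sum>m<k. lanczos_T A b k $$ (m, j) * q (Suc m) $ i)
      + (if j = k - 1 then \<beta> k * x $ (k - 1) * q (Suc k) $ i else 0)"
    proof (cases "Suc j < k")
      case True
      then show ?thesis unfolding Aq lanczos_T_column_sum[OF j i] by auto
    next
      case False
      with j have "k = Suc j" by simp
      then show ?thesis unfolding Aq lanczos_T_column_sum[OF j i] by (simp add: algebra_simps)
    qed
  qed
  also have "\<dots> = (\<Sum>j<k. x $ j * (\<Sum>m<k. lanczos_T A b k $$ (m, j) * q (Suc m) $ i))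
      + \<beta> k * x $ (k - 1) * q (Suc k) $ i"
    using k by (simp add: sum.distrib)
  also have "(\<Sum>j<k. x $ j * (\<Sum>m<k. lanczos_T A b k $$ (m, j) * q (Suc m) $ i))
      = (\<Sum>m<k. \<Sum>j<k. lanczos_T A b k $$ (m, j) * x $ j * q (Suc m) $ i)"
    unfolding sum_distrib_left by (subst sum.swap) (simp add: mult_ac)
  also have "\<dots> = (\<Sum>m<k. (lanczos_T A b k *\<^sub>v x) $ m * q (Suc m) $ i)"
    using x lanczos_T_carrier
    by (intro sum.cong refl) (auto simp: scalar_prod_def lessThan_atLeast0 sum_distrib_right intro!: sum.cong)
  also have "\<dots> = (lanczos_Q A b k *\<^sub>v (lanczos_T A b k *\<^sub>v x)) $ i"
    by (rule lanczos_Q_mult_vec[symmetric]) (use lanczos_T_carrier x i in auto)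
  finally show "(A *\<^sub>v (lanczos_Q A b k *\<^sub>v x)) $ i
    = (lanczos_Q A b k *\<^sub>v (lanczos_T A b k *\<^sub>v x) + (\<beta> k * x $ (k - 1)) \<cdot>\<^sub>v q (Suc k)) $ i"
    using i by (simp del: index_mult_mat_vec)
qed simp

section \<open>The shifted tridiagonal matrix and the Galerkin residual\<close>

lemma lanczos_T_cofactor:
  assumes k: "k \<ge> 1"
  shows "cofactor (lanczos_T A b k - z \<cdot>\<^sub>m 1\<^sub>m k) 0 (k - 1)
    = (- 1) ^ (k - 1) * prod_list (map (\<lambda>i. \<beta> (Suc i)) [0..<k - 1])"
proof -
  define X where "X = lanczos_T A b k - z \<cdot>\<^sub>m 1\<^sub>m k"
  define Y where "Y = mat_delete X 0 (k - 1)"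
  have X: "X \<in> carrier_mat k k" using lanczos_T_carrier by (auto simp: X_def)
  then have Y: "Y \<in> carrier_mat (k - 1) (k - 1)" by (auto simp: Y_def)
  \<comment> \<open>Deleting row 0 lifts the subdiagonal of \<open>X\<close> onto the diagonal of
    \<open>Y\<close>; everything below it vanishes because \<open>X\<close> is tridiagonal.\<close>
  have Y_index: "Y $$ (i, j) = X $$ (Suc i, j)" if "i < k - 1" "j < k - 1" for i j
    using that X by (auto simp: Y_def mat_delete_def)
  have "upper_triangular Y"
    using Y by (intro upper_triangularI) (auto simp: Y_index X_def lanczos_T_def)
  then have "det Y = prod_list (diag_mat Y)" using Y by (rule det_upper_triangular)
  also have "diag_mat Y = map (\<lambda>i. \<beta> (Suc i)) [0..<k - 1]"
    using Y by (auto simp: diag_mat_def Y_index X_def lanczos_T_def)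
  finally show ?thesis by (simp add: cofactor_def Y_def X_def)
qed

lemma lanczos_T_det:
  assumes "char_poly (lanczos_T A b k) = (\<Prod>i=1..k. [:- \<mu> i, 1:])"
  shows "det (lanczos_T A b k - z \<cdot>\<^sub>m 1\<^sub>m k) = (\<Prod>i=1..k. \<mu> i - z)"
proof -
  let ?X = "lanczos_T A b k - z \<cdot>\<^sub>m 1\<^sub>m k"
  have X: "?X \<in> carrier_mat k k" using lanczos_T_carrier by auto
  have "char_matrix (lanczos_T A b k) z = ?X"
    using lanczos_T_carrier by (intro eq_matI) (auto simp: char_matrix_def)
  then have "poly (char_poly (lanczos_T A b k)) z = det (- ?X)"
    using char_poly_matrix[OF lanczos_T_carrier] by metis
  also have "- ?X = (- 1) \<cdot>\<^sub>m ?X" by (intro eq_matI) auto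
  also have "det ((- 1) \<cdot>\<^sub>m ?X) = (- 1) ^ k * det ?X" using X by simp
  finally have "(- 1) ^ k * det ?X = (\<Prod>i=1..k. z - \<mu> i)"
    by (simp add: assms poly_prod)
  \<comment> \<open>The characteristic polynomial is the determinant of z I - T; a second factor
    (-1)^k reverses the sign of each of the k linear factors.\<close>
  then have "(- 1) ^ k * ((- 1) ^ k * det ?X) = (\<Prod>i=1..k. - 1) * (\<Prod>i=1..k. z - \<mu> i)" by simp
  also have "\<dots> = (\<Prod>i=1..k. \<mu> i - z)" by (simp only: prod.distrib[symmetric]) simp
  finally show ?thesis by (simp add: mult.assoc[symmetric] power_mult_distrib[symmetric])
qed

text \<open>The coordinates, in the Lanczos basis, of the approximate solution of (A - z I) x = b.
  Through \<open>matrix_fun\<close> the vector has the right dimension for every \<open>z\<close>,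
  even for an eigenvalue of T.\<close>

definition galerkin_coeffs :: "complex \<Rightarrow> complex Matrix.vec" where
  "galerkin_coeffs z = matrix_fun (\<lambda>x. 1 / (x - z)) (lanczos_T A b k) *\<^sub>v (mat_adjoint (lanczos_Q A b k) *\<^sub>v b)"

definition galerkin_residual :: "complex \<Rightarrow> complex Matrix.vec" where
  "galerkin_residual z = b - (A - z \<cdot>\<^sub>m 1\<^sub>m n) *\<^sub>v (lanczos_Q A b k *\<^sub>v galerkin_coeffs z)"

lemma lanczos_Qb_carrier: "mat_adjoint (lanczos_Q A b k) *\<^sub>v b \<in> carrier_vec k"
  by (rule mult_mat_vec_carrier[OF mat_adjoint_carrier[OF lanczos_Q_carrier] b])

lemma lanczos_projected_mult_vec:
  assumes "F \<in> carrier_mat k k"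
  shows "(lanczos_Q A b k * F * mat_adjoint (lanczos_Q A b k)) *\<^sub>v b
    = lanczos_Q A b k *\<^sub>v (F *\<^sub>v (mat_adjoint (lanczos_Q A b k) *\<^sub>v b))"
proof -
  note Q = lanczos_Q_carrier and Q' = mat_adjoint_carrier[OF lanczos_Q_carrier]
  show ?thesis
    unfolding assoc_mult_mat_vec[OF mult_carrier_mat[OF Q assms] Q' b]
    by (rule assoc_mult_mat_vec[OF Q assms lanczos_Qb_carrier])
qed

lemma galerkin_coeffs_carrier: "galerkin_coeffs z \<in> carrier_vec k"
  unfolding galerkin_coeffs_def
  by (rule mult_mat_vec_carrier[OF matrix_fun_carrier[OF lanczos_T_hermitian] lanczos_Qb_carrier])

lemma lanczos_shift_carrier: "A - z \<cdot>\<^sub>m 1\<^sub>m n \<in> carrier_mat n n"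
  using lanczos_A_carrier by auto

lemma galerkin_residual_carrier: "galerkin_residual z \<in> carrier_vec n"
  unfolding galerkin_residual_def
  using b mult_mat_vec_carrier[OF lanczos_shift_carrier mult_mat_vec_carrier[OF lanczos_Q_carrier galerkin_coeffs_carrier]]
  by auto

lemma galerkin_equation:
  assumes z: "z \<notin> spectrum (lanczos_T A b k)"
  shows "(lanczos_T A b k - z \<cdot>\<^sub>m 1\<^sub>m k) *\<^sub>v galerkin_coeffs z = mat_adjoint (lanczos_Q A b k) *\<^sub>v b"
proof -
  note H = lanczos_T_hermitian
  have "matrix_fun (\<lambda>x. x - z) (lanczos_T A b k) * matrix_fun (\<lambda>x. 1 / (x - z)) (lanczos_T A b k)
      = matrix_fun (\<lambda>x. 1) (lanczos_T A b k)"
    unfolding matrix_fun_mult[OF H] by (rule matrix_fun_cong[OF H]) (use z in auto)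
  then show ?thesis
    unfolding galerkin_coeffs_def matrix_fun_shift[OF H, symmetric]
      assoc_mult_mat_vec[OF matrix_fun_carrier[OF H] matrix_fun_carrier[OF H] lanczos_Qb_carrier, symmetric]
    by (simp add: matrix_fun_const[OF H] smult_one_mat_mult_vec[OF lanczos_Qb_carrier])
qed

text \<open>Deleting the first row and the last column of \<open>T - z I\<close> leaves a triangular matrix whose diagonal
  \<open>\<beta>\<^sub>1, \<dots>, \<beta>\<^sub>k\<^sub>-\<^sub>1\<close> does not involve \<open>z\<close>, so by Cramer's rule \<open>z\<close> enters the residual through the determinant only.\<close>

lemma galerkin_residual_det:
  "\<exists>r\<in>carrier_vec n. \<forall>z. z \<notin> spectrum (lanczos_T A b k) \<longrightarrow>
     det (lanczos_T A b k - z \<cdot>\<^sub>m 1\<^sub>m k) \<cdot>\<^sub>v galerkin_residual z = r"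
proof (cases "k = 0")
  case True
  have "det (lanczos_T A b k - z \<cdot>\<^sub>m 1\<^sub>m k) \<cdot>\<^sub>v galerkin_residual z = b" for z
  proof -
    have "det (lanczos_T A b k - z \<cdot>\<^sub>m 1\<^sub>m k) = 1"
      using True lanczos_T_carrier by (intro det_dim_zero) auto
    moreover have "lanczos_Q A b k *\<^sub>v galerkin_coeffs z = 0\<^sub>v n"
      using True lanczos_Q_mult_vec[OF galerkin_coeffs_carrier] lanczos_Q_carrier
      by (intro eq_vecI) (auto simp del: index_mult_mat_vec)
    moreover have "(A - z \<cdot>\<^sub>m 1\<^sub>m n) *\<^sub>v 0\<^sub>v n = 0\<^sub>v n"
      using lanczos_shift_carrier by (intro eq_vecI) auto
    ultimately show ?thesis using b by (simp add: galerkin_residual_def)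
  qed
  then show ?thesis using b by blast
next
  case False
  then have k: "k \<ge> 1" by simp
  let ?T = "lanczos_T A b k" and ?Q = "lanczos_Q A b k"
  \<comment> \<open>\<open>c\<close> is the cofactor that Cramer's rule selects. The residual is
    -\<beta>_k times the last coordinate of the coefficient vector, times q_(k+1); \<open>r\<close>
    is this after multiplication by the determinant, with the last coordinate eliminated.\<close>
  define c where "c = (- 1) ^ (k - 1) * prod_list (map (\<lambda>i. \<beta> (Suc i)) [0..<k - 1])"
  define r where "r = (- (\<beta> k * (complex_of_real (norm2_vec b) * c))) \<cdot>\<^sub>v q (Suc k)"
  have "det (?T - z \<cdot>\<^sub>m 1\<^sub>m k) \<cdot>\<^sub>v galerkin_residual z = r" if z: "z \<notin> spectrum ?T" for z
  proof -
    define x where "x = galerkin_coeffs z"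
    define X where "X = ?T - z \<cdot>\<^sub>m 1\<^sub>m k"
    have xc: "x \<in> carrier_vec k" unfolding x_def by (rule galerkin_coeffs_carrier)
    have X: "X \<in> carrier_mat k k" using lanczos_T_carrier by (auto simp: X_def)
    have Qx: "?Q *\<^sub>v x \<in> carrier_vec n" by (rule mult_mat_vec_carrier[OF lanczos_Q_carrier xc])
    have Tx: "?T *\<^sub>v x \<in> carrier_vec k" by (rule mult_mat_vec_carrier[OF lanczos_T_carrier xc])
    have nb0: "norm2_vec b \<noteq> 0" using nb by (simp add: lanczos_no_breakdown_def)
    have eq: "X *\<^sub>v x = complex_of_real (norm2_vec b) \<cdot>\<^sub>v unit_vec k 0"
      unfolding X_def x_def galerkin_equation[OF z] by (rule lanczos_Q_adjoint_b[OF k])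
    \<comment> \<open>Only the last coordinate of \<open>x\<close> enters the residual and the
      right-hand side is a multiple of the first unit vector, so a single entry of the adjugate
      decides.\<close>
    have "det X \<cdot>\<^sub>v x = adj_mat X *\<^sub>v (X *\<^sub>v x)"
      using adj_mat[OF X] X xc
      by (simp add: assoc_mult_mat_vec[of _ k k _ k, symmetric] smult_one_mat_mult_vec del: assoc_mult_mat_vec)
    also have "\<dots> = complex_of_real (norm2_vec b) \<cdot>\<^sub>v (adj_mat X *\<^sub>v unit_vec k 0)"
      unfolding eq by (rule mult_mat_vec[OF adj_mat(1)[OF X]]) simp
    also have "adj_mat X *\<^sub>v unit_vec k 0 = col (adj_mat X) 0"
      by (rule mult_mat_unit_vec[OF adj_mat(1)[OF X]]) (use k in simp)
    finally have "(det X \<cdot>\<^sub>v x) $ (k - 1) = complex_of_real (norm2_vec b) * adj_mat X $$ (k - 1, 0)"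
      using adj_mat(1)[OF X] k by simp
    also have "adj_mat X $$ (k - 1, 0) = c"
      using X k lanczos_T_cofactor[OF k, of z] by (simp add: adj_mat_def X_def c_def)
    finally have last: "det X * x $ (k - 1) = complex_of_real (norm2_vec b) * c"
      using xc k by simp
    have Xx: "X *\<^sub>v x = ?T *\<^sub>v x - z \<cdot>\<^sub>v x"
      using xc lanczos_T_carrier
      by (simp add: X_def minus_mult_distrib_mat_vec[of _ k k] smult_one_mat_mult_vec)
    \<comment> \<open>\<open>b\<close> is a multiple of q_1 and so lies in the range of Q. This is
      why it cancels completely from the residual, leaving only the q_(k+1) direction.\<close>
    have Qb: "?Q *\<^sub>v (X *\<^sub>v x) = b"
    proof -
      have "?Q *\<^sub>v (X *\<^sub>v x) = complex_of_real (norm2_vec b) \<cdot>\<^sub>v (?Q *\<^sub>v unit_vec k 0)"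
        unfolding eq by (rule mult_mat_vec[OF lanczos_Q_carrier]) simp
      also have "?Q *\<^sub>v unit_vec k 0 = q (Suc 0)"
        using k lanczos_Q_carrier
        by (subst mult_mat_unit_vec[OF lanczos_Q_carrier]) (auto simp: lanczos_Q_index intro!: eq_vecI)
      finally show ?thesis using nb0 by (simp add: lanczos_q_1 smult_smult_assoc)
    qed
    have cancel: "b - (b + u + s \<cdot>\<^sub>v v - u) = (- s) \<cdot>\<^sub>v v" if "u \<in> carrier_vec n" "v \<in> carrier_vec n" for u v s
      using that b by (intro eq_vecI) auto
    have "(A - z \<cdot>\<^sub>m 1\<^sub>m n) *\<^sub>v (?Q *\<^sub>v x) = A *\<^sub>v (?Q *\<^sub>v x) - z \<cdot>\<^sub>v (?Q *\<^sub>v x)"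
      using Qx lanczos_A_carrier by (simp add: minus_mult_distrib_mat_vec[of _ n n] smult_one_mat_mult_vec)
    also have "A *\<^sub>v (?Q *\<^sub>v x) = ?Q *\<^sub>v (?T *\<^sub>v x) + (\<beta> k * x $ (k - 1)) \<cdot>\<^sub>v q (Suc k)"
      by (rule lanczos_AQ[OF xc k])
    also have "?Q *\<^sub>v (?T *\<^sub>v x) = b + z \<cdot>\<^sub>v (?Q *\<^sub>v x)"
    proof -
      have "b = ?Q *\<^sub>v (?T *\<^sub>v x) - z \<cdot>\<^sub>v (?Q *\<^sub>v x)"
        using Qb Tx xc mult_minus_distrib_mat_vec[OF lanczos_Q_carrier Tx, of "z \<cdot>\<^sub>v x"]
          mult_mat_vec[OF lanczos_Q_carrier xc, of z] by (simp add: Xx)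
      moreover have "u = (u - v) + v" if "u \<in> carrier_vec n" "v \<in> carrier_vec n" for u v :: "complex Matrix.vec"
        using that by (intro eq_vecI) auto
      ultimately show ?thesis
        using mult_mat_vec_carrier[OF lanczos_Q_carrier Tx] smult_carrier_vec[of z] Qx by metis
    qed
    finally have res: "galerkin_residual z = (- (\<beta> k * x $ (k - 1))) \<cdot>\<^sub>v q (Suc k)"
      unfolding galerkin_residual_def x_def[symmetric]
      using cancel[of "z \<cdot>\<^sub>v (?Q *\<^sub>v x)"] Qx lanczos_q_carrier by simp
    have "det X * (- (\<beta> k * x $ (k - 1))) = - (\<beta> k * (complex_of_real (norm2_vec b) * c))"
      unfolding last[symmetric] by simp
    then show ?thesis unfolding X_def[symmetric] r_def by (simp only: res smult_smult_assoc)
  qed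
  then show ?thesis using lanczos_q_carrier by (intro bexI[of _ r]) (auto simp: r_def)
qed

text \<open>The error of an approximate solution is the resolvent applied to its residual.\<close>

lemma lanczos_err_eq:
  assumes zA: "z \<notin> spectrum A" and zT: "z \<notin> spectrum (lanczos_T A b k)"
  shows "lanczos_err A b k z = matrix_fun (\<lambda>x. 1 / (x - z)) A *\<^sub>v galerkin_residual z"
proof -
  let ?F = "matrix_fun (\<lambda>x. 1 / (x - z)) A" and ?Q = "lanczos_Q A b k"
  have F: "?F \<in> carrier_mat n n" by (rule matrix_fun_carrier[OF A])
  have Qx: "?Q *\<^sub>v galerkin_coeffs z \<in> carrier_vec n"
    by (rule mult_mat_vec_carrier[OF lanczos_Q_carrier galerkin_coeffs_carrier])
  have "?F * matrix_fun (\<lambda>x. x - z) A = matrix_fun (\<lambda>x. 1) A"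
    unfolding matrix_fun_mult[OF A] by (rule matrix_fun_cong[OF A]) (use zA in auto)
  then have "?F *\<^sub>v ((A - z \<cdot>\<^sub>m 1\<^sub>m n) *\<^sub>v (?Q *\<^sub>v galerkin_coeffs z)) = ?Q *\<^sub>v galerkin_coeffs z"
    unfolding assoc_mult_mat_vec[OF F lanczos_shift_carrier Qx, symmetric]
    unfolding matrix_fun_shift[OF A, symmetric]
    by (simp add: matrix_fun_const[OF A] smult_one_mat_mult_vec[OF Qx])
  then have "?F *\<^sub>v galerkin_residual z = ?F *\<^sub>v b - ?Q *\<^sub>v galerkin_coeffs z"
    unfolding galerkin_residual_def
    by (subst mult_minus_distrib_mat_vec[OF F b mult_mat_vec_carrier[OF lanczos_shift_carrier Qx]]) simp
  moreover have "(?Q * matrix_fun (\<lambda>x. 1 / (x - z)) (lanczos_T A b k) * mat_adjoint ?Q) *\<^sub>v b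
      = ?Q *\<^sub>v galerkin_coeffs z"
    unfolding galerkin_coeffs_def by (rule lanczos_projected_mult_vec[OF matrix_fun_carrier[OF lanczos_T_hermitian]])
  ultimately show ?thesis
    by (simp add: lanczos_err_def shifted_inverse_eq_matrix_fun[OF A zA]
        shifted_inverse_eq_matrix_fun[OF lanczos_T_hermitian zT])
qed

lemma lanczos_err_carrier:
  assumes zA: "z \<notin> spectrum A" and zT: "z \<notin> spectrum (lanczos_T A b k)"
  shows "lanczos_err A b k z \<in> carrier_vec n"
  unfolding lanczos_err_eq[OF assms]
  by (rule mult_mat_vec_carrier[OF matrix_fun_carrier[OF A] galerkin_residual_carrier])

text \<open>Multiplied by their determinants the residuals at \<open>z\<close> and \<open>w\<close>
  coincide, so they differ by the scalar \<open>D w / D z\<close>, which factors over the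
  eigenvalues of T. Replacing the resolvent at \<open>w\<close> by the one at \<open>z\<close> costs
  the factor h(A).\<close>

lemma lanczos_err_shift:
  assumes cp: "char_poly (lanczos_T A b k) = (\<Prod>i=1..k. [:- \<mu> i, 1:])"
    and z: "z \<notin> spectrum A" "z \<notin> spectrum (lanczos_T A b k)"
    and w: "w \<notin> spectrum A" "w \<notin> spectrum (lanczos_T A b k)"
  shows "lanczos_err A b k z
    = (\<Prod>i=1..k. h_fun w z (\<mu> i)) \<cdot>\<^sub>v (matrix_fun (h_fun w z) A *\<^sub>v lanczos_err A b k w)"
proof -
  let ?T = "lanczos_T A b k"
  let ?F = "\<lambda>z. matrix_fun (\<lambda>x. 1 / (x - z)) A"
  note F = matrix_fun_carrier[OF A]
  define D where "D z = det (?T - z \<cdot>\<^sub>m 1\<^sub>m k)" for z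
  have Dz: "D z \<noteq> 0"
  proof -
    have "spectrum ?T = {x. poly (char_poly ?T) x = 0}"
      by (rule spectrum_root_char_poly[OF lanczos_T_carrier])
    then have "\<mu> i \<noteq> z" if "i \<in> {1..k}" for i
      using z(2) that by (auto simp: cp poly_prod)
    then show ?thesis by (simp add: D_def lanczos_T_det[OF cp])
  qed
  obtain r where r: "D z \<cdot>\<^sub>v galerkin_residual z = r" "D w \<cdot>\<^sub>v galerkin_residual w = r"
    using galerkin_residual_det z(2) w(2) unfolding D_def by blast
  then have "(1 / D z) \<cdot>\<^sub>v (D z \<cdot>\<^sub>v galerkin_residual z) = (1 / D z) \<cdot>\<^sub>v (D w \<cdot>\<^sub>v galerkin_residual w)"
    by simp
  then have res: "galerkin_residual z = (D w / D z) \<cdot>\<^sub>v galerkin_residual w"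
    using Dz by (simp add: smult_smult_assoc)
  have "matrix_fun (h_fun w z) A *\<^sub>v lanczos_err A b k w = (matrix_fun (h_fun w z) A * ?F w) *\<^sub>v galerkin_residual w"
    unfolding lanczos_err_eq[OF w] by (rule assoc_mult_mat_vec[OF F F galerkin_residual_carrier, symmetric])
  also have "matrix_fun (h_fun w z) A * ?F w = ?F z"
    unfolding matrix_fun_mult[OF A] by (rule matrix_fun_cong[OF A]) (use w(1) in \<open>auto simp: h_fun_def\<close>)
  finally have h: "matrix_fun (h_fun w z) A *\<^sub>v lanczos_err A b k w = ?F z *\<^sub>v galerkin_residual w" .
  have "lanczos_err A b k z = (D w / D z) \<cdot>\<^sub>v (?F z *\<^sub>v galerkin_residual w)"
    unfolding lanczos_err_eq[OF z] by (subst res) (rule mult_mat_vec[OF F galerkin_residual_carrier])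
  also have "D w / D z = (\<Prod>i=1..k. h_fun w z (\<mu> i))"
    by (simp add: D_def lanczos_T_det[OF cp] h_fun_def prod_dividef)
  finally show ?thesis unfolding h .
qed

section \<open>The error as a finite combination of point values\<close>

lemma lanczos_approx_eq:
  "lanczos_approx A b k g
    = lanczos_Q A b k *\<^sub>v (matrix_fun g (lanczos_T A b k) *\<^sub>v (mat_adjoint (lanczos_Q A b k) *\<^sub>v b))"
  unfolding lanczos_approx_def by (rule lanczos_projected_mult_vec[OF matrix_fun_carrier[OF lanczos_T_hermitian]])

lemma lanczos_approx_carrier: "lanczos_approx A b k g \<in> carrier_vec n"
  unfolding lanczos_approx_eq
  by (rule mult_mat_vec_carrier[OF lanczos_Q_carrier
        mult_mat_vec_carrier[OF matrix_fun_carrier[OF lanczos_T_hermitian] lanczos_Qb_carrier]])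

lemma lanczos_err_eq_approx:
  assumes "z \<notin> spectrum A" "z \<notin> spectrum (lanczos_T A b k)"
  shows "lanczos_err A b k z
    = matrix_fun (\<lambda>x. 1 / (x - z)) A *\<^sub>v b - lanczos_approx A b k (\<lambda>x. 1 / (x - z))"
  by (simp add: lanczos_err_def lanczos_approx_def shifted_inverse_eq_matrix_fun[OF A assms(1)]
      shifted_inverse_eq_matrix_fun[OF lanczos_T_hermitian assms(2)])

text \<open>Moving Q to the other side of the inner product makes the Lanczos part a functional of T
  alone, entered with negative weights. The disjoint sum of index sets keeps the nodes from
  \<open>A\<close> and from T apart even where eigenvalues coincide.\<close>

lemma lanczos_error_functional:
  assumes y: "y \<in> carrier_vec n"
  shows "\<exists>c p. (\<forall>i\<in>{..<n} <+> {..<k}. p i \<in> spectrum A \<union> spectrum (lanczos_T A b k)) \<and>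
    (\<forall>g. (matrix_fun g A *\<^sub>v b - lanczos_approx A b k g) \<bullet>c y = (\<Sum>i\<in>{..<n} <+> {..<k}. c i * g (p i)))"
proof -
  let ?T = "lanczos_T A b k" and ?Q = "lanczos_Q A b k"
  note T = lanczos_T_hermitian
  have Qy: "mat_adjoint ?Q *\<^sub>v y \<in> carrier_vec k"
    by (rule mult_mat_vec_carrier[OF mat_adjoint_carrier[OF lanczos_Q_carrier] y])
  obtain c d where d: "\<forall>i<n. d i \<in> spectrum A"
    and c: "\<And>g. (matrix_fun g A *\<^sub>v b) \<bullet>c y = (\<Sum>i<n. c i * g (d i))"
    using matrix_fun_cscalar_prod[OF A b y] by blast
  obtain c' d' where d': "\<forall>i<k. d' i \<in> spectrum ?T"
    and c': "\<And>g. (matrix_fun g ?T *\<^sub>v (mat_adjoint ?Q *\<^sub>v b)) \<bullet>c (mat_adjoint ?Q *\<^sub>v y) = (\<Sum>i<k. c' i * g (d' i))"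
    using matrix_fun_cscalar_prod[OF T lanczos_Qb_carrier Qy] by blast
  have "(matrix_fun g A *\<^sub>v b - lanczos_approx A b k g) \<bullet>c y
    = (\<Sum>i\<in>{..<n} <+> {..<k}. case_sum c (\<lambda>j. - c' j) i * g (case_sum d d' i))" for g
  proof -
    have "(matrix_fun g A *\<^sub>v b - lanczos_approx A b k g) \<bullet>c y
        = (matrix_fun g A *\<^sub>v b) \<bullet>c y - lanczos_approx A b k g \<bullet>c y"
      by (rule cscalar_prod_diff_left)
         (use y matrix_fun_carrier[OF A, of g] lanczos_approx_carrier[of g] in auto)
    also have "lanczos_approx A b k g \<bullet>c y = (\<Sum>i<k. c' i * g (d' i))"
      unfolding lanczos_approx_eq c'[symmetric]
      by (rule cscalar_prod_adjoint[OF lanczos_Q_carrier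
            mult_mat_vec_carrier[OF matrix_fun_carrier[OF T] lanczos_Qb_carrier] y])
    finally show ?thesis by (simp add: c sum.Plus sum_negf)
  qed
  then show ?thesis using d d'
    by (intro exI[of _ "case_sum c (\<lambda>j. - c' j)"] exI[of _ "case_sum d d'"]) auto
qed

end

section \<open>Assembling the bound\<close>

lemma h_norm_ge:
  assumes "x \<in> S" "complex_of_real x \<noteq> z"
  shows "ennreal (cmod (h_fun w z (complex_of_real x))) \<le> h_norm w z S"
  using SUP_upper[of x S "\<lambda>x. if complex_of_real x = z then \<infinity> else ennreal (cmod (h_fun w z (complex_of_real x)))"]
    assms by (simp add: h_norm_def)

lemma prod_mono_ennreal:
  fixes f g :: "'i \<Rightarrow> ennreal"
  shows "(\<And>i. i \<in> I \<Longrightarrow> f i \<le> g i) \<Longrightarrow> prod f I \<le> prod g I"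
  by (induction I rule: infinite_finite_induct) (auto intro: mult_mono)

theorem theorem2p6:
  fixes A M :: "complex mat" and b :: "complex Matrix.vec" and n k :: nat
    and f :: "complex \<Rightarrow> complex" and N :: "complex set" and \<Gamma> :: "(real \<Rightarrow> complex) set"
    and w :: complex and \<mu> :: "nat \<Rightarrow> complex" and S :: "nat \<Rightarrow> real set"
  assumes "hermitian_mat n A"
    and "b \<in> carrier_vec n" and "b \<noteq> 0\<^sub>v n"
    and "lanczos_no_breakdown A b k"
    and "open N" and "spectrum A \<union> spectrum (lanczos_T A b k) \<subseteq> N" and "f analytic_on N"
    and "finite \<Gamma>"
    and "\<And>\<gamma>. \<gamma> \<in> \<Gamma> \<Longrightarrow> valid_path \<gamma> \<and> simple_path \<gamma> \<and> pathfinish \<gamma> = pathstart \<gamma>"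
    and "\<And>\<gamma>. \<gamma> \<in> \<Gamma> \<Longrightarrow> path_image \<gamma> \<union> inside (path_image \<gamma>) \<subseteq> N"
    and "\<And>ev. ev \<in> spectrum A \<union> spectrum (lanczos_T A b k) \<Longrightarrow>
           (\<forall>\<gamma>\<in>\<Gamma>. ev \<notin> path_image \<gamma>) \<and> (\<exists>!\<gamma>. \<gamma> \<in> \<Gamma> \<and> ev \<in> inside (path_image \<gamma>))"
    and "w \<notin> spectrum (lanczos_T A b k) \<union> spectrum A"
    and "char_poly (lanczos_T A b k) = (\<Prod>i=1..k. [:- \<mu> i, 1:])"
    and "spectrum A \<subseteq> complex_of_real ` S 0"
    and "\<And>i. i \<in> {1..k} \<Longrightarrow> \<mu> i \<in> complex_of_real ` S i"
    and "pos_def_mat n M" and "M * A = A * M"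
  shows "ennreal (induced_norm M (matrix_fun f A *\<^sub>v b - lanczos_approx A b k f))
    \<le> ennreal (1 / (2 * pi)) *
      (\<Sum>\<gamma>\<in>\<Gamma>. arc_length_integral
         (\<lambda>z. ennreal (cmod (f z)) * (\<Prod>i=1..k. h_norm w z (S i)) * h_norm w z (S 0)) \<gamma>) *
      ennreal (induced_norm M (lanczos_err A b k w))"
proof -
  note A = assms(1) and b = assms(2) and nb = assms(4) and spec_N = assms(6) and fin = assms(8)
    and path = assms(9) and sub = assms(10) and encl = assms(11) and cp = assms(13)
    and S0 = assms(14) and Si = assms(15) and M = assms(16) and MA = assms(17)
  let ?T = "lanczos_T A b k"
  define v where "v = matrix_fun f A *\<^sub>v b - lanczos_approx A b k f"
  define nv where "nv = induced_norm M v"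
  define e where "e = lanczos_err A b k w"
  define ne where "ne = induced_norm M e"
  define g where "g z = ennreal (cmod (f z)) * (\<Prod>i=1..k. h_norm w z (S i)) * h_norm w z (S 0)" for z
  have wA: "w \<notin> spectrum A" and wT: "w \<notin> spectrum ?T" using assms(12) by auto
  have Ac: "A \<in> carrier_mat n n" using A by (simp add: hermitian_mat_def)
  have MH: "hermitian_mat n M" using M by (simp add: pos_def_mat_def)
  then have Mc: "M \<in> carrier_mat n n" by (simp add: hermitian_mat_def)
  have Tc: "?T \<in> carrier_mat k k" by (rule lanczos_T_carrier[OF A b nb])
  have v: "v \<in> carrier_vec n"
    unfolding v_def using mult_mat_vec_carrier[OF matrix_fun_carrier[OF A] b] lanczos_approx_carrier[OF A b nb]
    by auto
  have e: "e \<in> carrier_vec n" unfolding e_def by (rule lanczos_err_carrier[OF A b nb wA wT])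
  have nn: "nv \<ge> 0" "ne \<ge> 0"
    unfolding nv_def ne_def induced_norm_def
    using pos_def_quadratic_nonneg[OF M v] pos_def_quadratic_nonneg[OF M e] by auto
  \<comment> \<open>A nonempty spectrum is needed for the maximum \<open>m\<close> below.\<close>
  have "n \<noteq> 0"
  proof
    assume "n = 0"
    then have "b = 0\<^sub>v n" using b by (intro eq_vecI) auto
    with assms(3) show False by simp
  qed
  then have spec: "spectrum A \<noteq> {}" "finite (spectrum A)"
    using spectrum_non_empty[OF Ac] card_finite_spectrum[OF Ac] by auto
  \<comment> \<open>Testing against \<open>M v\<close> reduces the bound on \<open>v\<close> to scalar contour integrals.\<close>
  define y where "y = M *\<^sub>v v"
  have y: "y \<in> carrier_vec n" unfolding y_def by (rule mult_mat_vec_carrier[OF Mc v])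
  obtain c p where p': "\<forall>i\<in>{..<n} <+> {..<k}. p i \<in> spectrum A \<union> spectrum ?T"
    and c': "\<forall>g. (matrix_fun g A *\<^sub>v b - lanczos_approx A b k g) \<bullet>c y = (\<Sum>i\<in>{..<n} <+> {..<k}. c i * g (p i))"
    using lanczos_error_functional[OF A b nb y] by (elim exE conjE) (rule that; assumption)
  note p = p'[rule_format] and c = c'[rule_format]
  \<comment> \<open>On the curves the sum is the functional at \<open>1 / (x - z)\<close>, so
    \<open>F z\<close> is f(z) times the pairing of err_k(z) with \<open>y\<close>.\<close>
  define F where "F z = f z * (\<Sum>i\<in>{..<n} <+> {..<k}. c i / (p i - z))" for z
  \<comment> \<open>Of the two constants, \<open>nv\<close> comes from Cauchy-Schwarz against
    \<open>v\<close>, and \<open>ne\<close> is the norm of err_k(w), to which err_k(z) is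
    reduced.\<close>
  have bound: "ennreal (cmod (F z)) \<le> ennreal (nv * ne) * g z" if \<gamma>: "\<gamma> \<in> \<Gamma>" and z: "z \<in> path_image \<gamma>" for \<gamma> z
  proof -
    have zA: "z \<notin> spectrum A" and zT: "z \<notin> spectrum ?T" using encl[of z] \<gamma> z by auto
    \<comment> \<open>The operator bound needs a real constant, while \<open>h_norm\<close> over S_0
      may be infinite. The maximum over the spectrum is real, and it is attained at a point of S_0,
      so \<open>h_norm\<close> dominates it.\<close>
    define m where "m = Max ((\<lambda>x. cmod (h_fun w z x)) ` spectrum A)"
    have m_ge: "cmod (h_fun w z x) \<le> m" if "x \<in> spectrum A" for x
      unfolding m_def using spec that by (intro Max_ge) auto
    have "m \<in> (\<lambda>x. cmod (h_fun w z x)) ` spectrum A"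
      unfolding m_def using spec by (intro Max_in) auto
    then obtain x0 where x0: "x0 \<in> spectrum A" "m = cmod (h_fun w z x0)" by auto
    then have m0: "m \<ge> 0" by simp
    from x0 S0 obtain t where t: "t \<in> S 0" "x0 = complex_of_real t" by auto
    have m_le: "ennreal m \<le> h_norm w z (S 0)"
      unfolding x0(2) t(2) by (rule h_norm_ge) (use t x0 zA in auto)
    have \<mu>_le: "ennreal (cmod (h_fun w z (\<mu> i))) \<le> h_norm w z (S i)" if i: "i \<in> {1..k}" for i
    proof -
      have "\<mu> i \<in> spectrum ?T"
        using i by (auto simp: spectrum_root_char_poly[OF Tc] cp poly_prod)
      then have "\<mu> i \<noteq> z" using zT by auto
      moreover obtain t where "t \<in> S i" "\<mu> i = complex_of_real t" using Si[OF i] by auto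
      ultimately show ?thesis using h_norm_ge[of t "S i" z w] by auto
    qed
    let ?P = "\<Prod>i=1..k. h_fun w z (\<mu> i)"
    let ?he = "matrix_fun (h_fun w z) A *\<^sub>v e"
    have he: "?he \<in> carrier_vec n" by (rule mult_mat_vec_carrier[OF matrix_fun_carrier[OF A] e])
    have "(\<Sum>i\<in>{..<n} <+> {..<k}. c i / (p i - z)) = lanczos_err A b k z \<bullet>c y"
      unfolding lanczos_err_eq_approx[OF A b nb zA zT] c by simp
    also have "lanczos_err A b k z = ?P \<cdot>\<^sub>v ?he"
      unfolding e_def by (rule lanczos_err_shift[OF A b nb cp zA zT wA wT])
    also have "(?P \<cdot>\<^sub>v ?he) \<bullet>c y = ?P * (?he \<bullet>c y)"
      by (rule cscalar_prod_smult_left) (use carrier_vecD[OF he] carrier_vecD[OF y] in \<open>simp only:\<close>)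
    also have "?he \<bullet>c y = (M *\<^sub>v ?he) \<bullet>c v"
      unfolding y_def by (rule hermitian_cscalar_prod[OF MH he v, symmetric])
    finally have "cmod (F z) = cmod (f z) * cmod ?P * cmod ((M *\<^sub>v ?he) \<bullet>c v)"
      by (simp add: F_def norm_mult)
    also have "\<dots> \<le> cmod (f z) * cmod ?P * (m * ne * nv)"
    proof (intro mult_left_mono)
      have "cmod ((M *\<^sub>v ?he) \<bullet>c v) \<le> induced_norm M ?he * nv"
        unfolding nv_def by (rule induced_norm_Cauchy_Schwarz[OF M he v])
      also have "\<dots> \<le> (m * ne) * nv"
        unfolding ne_def
        by (intro mult_right_mono induced_norm_matrix_fun_le[OF A M MA e m0 m_ge] nn)
      finally show "cmod ((M *\<^sub>v ?he) \<bullet>c v) \<le> m * ne * nv" .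
    qed auto
    also have "\<dots> = (nv * ne) * (cmod (f z) * cmod ?P * m)" by (simp add: mult_ac)
    finally have "ennreal (cmod (F z)) \<le> ennreal ((nv * ne) * (cmod (f z) * cmod ?P * m))"
      by (rule ennreal_leI)
    also have "\<dots> = ennreal (nv * ne) * (ennreal (cmod (f z)) * ennreal (cmod ?P) * ennreal m)"
      using nn m0 by (simp add: ennreal_mult)
    also have "\<dots> \<le> ennreal (nv * ne) * g z"
    proof -
      have "ennreal (cmod ?P) = (\<Prod>i=1..k. ennreal (cmod (h_fun w z (\<mu> i))))"
        by (simp add: prod_norm[symmetric] prod_ennreal)
      also have "\<dots> \<le> (\<Prod>i=1..k. h_norm w z (S i))"
        by (rule prod_mono_ennreal[OF \<mu>_le])
      finally show ?thesis
        unfolding g_def by (intro mult_left_mono mult_mono m_le) auto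
    qed
    finally show ?thesis .
  qed
  have hol: "f holomorphic_on N" using assms(7) by (rule analytic_imp_holomorphic)
  have arc: "ennreal (cmod (contour_integral \<gamma> F)) \<le> ennreal (nv * ne) * arc_length_integral g \<gamma>" if \<gamma>: "\<gamma> \<in> \<Gamma>" for \<gamma>
  proof (rule contour_integral_arc_length_bound)
    show "valid_path \<gamma>" using path[OF \<gamma>] by simp
    have "continuous_on (path_image \<gamma>) f"
      using hol sub[OF \<gamma>] by (intro holomorphic_on_imp_continuous_on) (auto intro: holomorphic_on_subset)
    moreover have "p i - z \<noteq> 0" if "i \<in> {..<n} <+> {..<k}" "z \<in> path_image \<gamma>" for i z
      using encl[OF p[OF that(1)]] \<gamma> that(2) by auto
    ultimately show "continuous_on (path_image \<gamma>) F"
      unfolding F_def by (intro continuous_intros) auto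
  qed (use nn bound[OF \<gamma>] in auto)
  show ?thesis
  \<comment> \<open>Both sides of the estimate below carry a factor \<open>nv\<close>, and
    cancelling it in \<open>ennreal\<close> requires it to be nonzero.\<close>
  proof (cases "nv = 0")
    case True
    then show ?thesis by (simp add: nv_def v_def)
  next
    case False
    with nn have nv: "nv > 0" by simp
    have "nv\<^sup>2 = Re ((M *\<^sub>v v) \<bullet>c v)"
      unfolding nv_def induced_norm_def using pos_def_quadratic_nonneg[OF M v] by simp
    also have "(M *\<^sub>v v) \<bullet>c v = v \<bullet>c y"
      unfolding y_def by (rule hermitian_cscalar_prod[OF MH v v])
    also have "Re (v \<bullet>c y) \<le> cmod (v \<bullet>c y)" by (rule complex_Re_le_cmod)
    also have "v \<bullet>c y = (\<Sum>i\<in>{..<n} <+> {..<k}. c i * f (p i))"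
      unfolding v_def by (rule c)
    also have "cmod \<dots> \<le> 1 / (2 * pi) * (\<Sum>\<gamma>\<in>\<Gamma>. cmod (contour_integral \<gamma> F))"
      unfolding F_def
      by (rule enclosed_sum_contour_bound[OF _ \<open>open N\<close> hol fin path sub
            subsetD[OF spec_N p] encl[OF p]]) simp
    finally have "ennreal (nv\<^sup>2) \<le> ennreal (1 / (2 * pi) * (\<Sum>\<gamma>\<in>\<Gamma>. cmod (contour_integral \<gamma> F)))"
      by (rule ennreal_leI)
    also have "\<dots> = ennreal (1 / (2 * pi)) * (\<Sum>\<gamma>\<in>\<Gamma>. ennreal (cmod (contour_integral \<gamma> F)))"
      by (subst ennreal_mult) (auto simp: sum_nonneg)
    also have "\<dots> \<le> ennreal (1 / (2 * pi)) * (\<Sum>\<gamma>\<in>\<Gamma>. ennreal (nv * ne) * arc_length_integral g \<gamma>)"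
      by (intro mult_left_mono sum_mono arc) auto
    also have "\<dots> = ennreal nv * (ennreal (1 / (2 * pi)) * (\<Sum>\<gamma>\<in>\<Gamma>. arc_length_integral g \<gamma>) * ennreal ne)"
      using nn by (simp add: ennreal_mult mult_ac sum_distrib_left[symmetric])
    finally have "ennreal nv * ennreal nv
        \<le> ennreal nv * (ennreal (1 / (2 * pi)) * (\<Sum>\<gamma>\<in>\<Gamma>. arc_length_integral g \<gamma>) * ennreal ne)"
      using nn by (simp add: power2_eq_square ennreal_mult)
    then have "ennreal nv \<le> ennreal (1 / (2 * pi)) * (\<Sum>\<gamma>\<in>\<Gamma>. arc_length_integral g \<gamma>) * ennreal ne"
      using nv by (subst (asm) ennreal_mult_le_mult_iff) auto
    then show ?thesis unfolding nv_def v_def ne_def e_def g_def .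
  qed
qed

end
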